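(* Let $N_x\ge3$, $r\ge1$ with $4r+1\le\min(N_x,N_\mu)$, $\Delta x=1/N_x$, $\Delta t>0$, $\sigma\ge0$. Let $\mathbf B^0\in\mathbb R^{N_x}$ have nonzero entries and let $\mathbf v^0=\mathbf X^0\mathbf S^0\mathbf V^{0,\top}$ be a rank-$r$ representation ($\mathbf X^0\in\mathbb R^{N_x\times r}$, $\mathbf V^0\in\mathbb R^{N_\mu\times r}$ with orthonormal columns, $\mathbf S^0\in\mathbb R^{r\times r}$). Let $\mathbf B^1$ and $\mathbf v^1=\mathbf X^1\mathbf S^1\mathbf V^{1,\top}$ be the result of one (well-defined) time step of the dynamical low-rank (DLRA) scheme for the multiplicative Su-Olson problem described in the context. Under the time step restriction $\Delta t\le\Delta x$ the scheme is energy stable, i.e. $E^1\le E^0$, where for $n\in\{0,1\}$ $$E^n=\tfrac12\sum_{j=1}^{N_x}\sum_{k=0}^{N_\mu-1}\left(B_j^nv_{jk}^n\right)^2+\tfrac12\sum_{j=1}^{N_x}\left(B_j^n\right)^2 .$$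
   Context: Indices: spatial $i,j\in\{1,\dots,N_x\}$ (periodic), angular $k,\ell\in\{0,\dots,N_\mu-1\}$ (columns/rows of angular objects are numbered from $0$). $\mathbf e_1\in\mathbb R^{N_\mu}$ is the first unit vector (corresponding to angular index $0$). Angular matrices: $P_\ell$ is the Legendre polynomial of degree $\ell$ with $\int_{-1}^1P_kP_\ell\,d\mu=\delta_{k\ell}$; $\mathbf A\in\mathbb R^{N_\mu\times N_\mu}$, $A_{k\ell}=\int_{-1}^1\mu P_kP_\ell\,d\mu$, is symmetric, $\mathbf A=\mathbf Q\mathbf M\mathbf Q^\top$ with $\mathbf Q$ orthogonal, $\mathbf M$ diagonal; $|\mathbf A|:=\mathbf Q|\mathbf M|\mathbf Q^\top$. Stencil matrices $\mathbf D^x,\mathbf D^{xx}\in\mathbb R^{N_x\times N_x}$ (indices modulo $N_x$): $D^x_{j,j\pm1}=\frac{\pm1}{2\Delta x}$, $D^{xx}_{j,j}=-\frac1{\Delta x}$, $D^{xx}_{j,j\pm1}=\frac1{2\Delta x}$, all other entries $0$. Put $\mathbf G^x=\mathrm{diag}(\mathbf B^0)^{-1}\mathbf D^x\,\mathrm{diag}(\mathbf B^0)$ and $\mathbf G^{xx}=\mathrm{diag}(\mathbf B^0)^{-1}\mathbf D^{xx}\,\mathrm{diag}(\mathbf B^0)$. $\mathrm{qr}(\mathbf Z)$ denotes a matrix with orthonormal columns, as many as $\mathbf Z$ has, whose range contains the range of $\mathbf Z$ (the orthonormal factor of a QR decomposition), its first column being the normalized first column of $\mathbf Z$ when that is nonzero.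 One step of the DLRA scheme: 1. K-step. $\mathbf K^0=\mathbf X^0\mathbf S^0$, $\mathbf K^\ast=\frac1{1+\sigma\Delta t}\big(\mathbf K^0-\Delta t\,\mathbf G^x\mathbf K^0\mathbf V^{0,\top}\mathbf A\mathbf V^0+\Delta t\,\mathbf G^{xx}\mathbf K^0\mathbf V^{0,\top}|\mathbf A|\mathbf V^0\big)$; $\widehat{\mathbf X}^\ast=\mathrm{qr}([\mathbf K^\ast,\mathbf X^0])$ and $\widehat{\widehat{\mathbf X}}{}^\ast=\mathrm{qr}([\widehat{\mathbf X}^\ast,\mathbf G^x\mathbf X^0,\mathbf G^{xx}\mathbf X^0])\in\mathbb R^{N_x\times4r}$. 2. L-step. $\mathbf L^0=\mathbf V^0\mathbf S^{0,\top}$, $\mathbf L^\ast=\frac1{1+\sigma\Delta t}\big(\mathbf L^0-\Delta t\,\mathbf A\mathbf L^0\mathbf X^{0,\top}(\mathbf G^x)^\top\mathbf X^0+\Delta t\,|\mathbf A|\mathbf L^0\mathbf X^{0,\top}(\mathbf G^{xx})^\top\mathbf X^0\big)$; $\widehat{\mathbf V}^\ast=\mathrm{qr}([\mathbf L^\ast,\mathbf V^0])$ and $\widehat{\widehat{\mathbf V}}{}^\ast=\mathrm{qr}([\widehat{\mathbf V}^\ast,\mathbf A^\top\mathbf V^0,|\mathbf A|^\top\mathbf V^0])\in\mathbb R^{N_\mu\times4r}$. 3. S-step. $\widetilde{\mathbf S}^0=\big(\widehat{\widehat{\mathbf X}}{}^{\ast,\top}\mathbf X^0\big)\mathbf S^0\big(\widehat{\widehat{\mathbf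 V}}{}^{\ast,\top}\mathbf V^0\big)^\top$, $\widehat{\widehat{\mathbf S}}{}^\ast=\frac1{1+\sigma\Delta t}\big(\widetilde{\mathbf S}^0-\Delta t\,\widehat{\widehat{\mathbf X}}{}^{\ast,\top}\mathbf G^x\widehat{\widehat{\mathbf X}}{}^\ast\widetilde{\mathbf S}^0\widehat{\widehat{\mathbf V}}{}^{\ast,\top}\mathbf A\widehat{\widehat{\mathbf V}}{}^\ast+\Delta t\,\widehat{\widehat{\mathbf X}}{}^{\ast,\top}\mathbf G^{xx}\widehat{\widehat{\mathbf X}}{}^\ast\widetilde{\mathbf S}^0\widehat{\widehat{\mathbf V}}{}^{\ast,\top}|\mathbf A|\widehat{\widehat{\mathbf V}}{}^\ast\big)$. 4. Coupled update of zeroth moment and internal energy. $v_{j0}^1$ and $B_j^1$ solve, for every $j$, $\frac{B_j^1}{B_j^0}v_{j0}^1=\frac1{1+\sigma\Delta t}\Big(\big(\mathbf X^0\mathbf S^0\mathbf V^{0,\top}\big)_{j0}-\Delta t\big(\mathbf G^x\widehat{\widehat{\mathbf X}}{}^\ast\widetilde{\mathbf S}^0\widehat{\widehat{\mathbf V}}{}^{\ast,\top}\mathbf A\big)_{j0}+\Delta t\big(\mathbf G^{xx}\widehat{\widehat{\mathbf X}}{}^\ast\widetilde{\mathbf S}^0\widehat{\widehat{\mathbf V}}{}^{\ast,\top}|\mathbf A|\big)_{j0}+\sqrt2\,\sigma\Delta t\frac{B_j^1}{B_j^0}\Big)$, $\frac{B_j^1}{B_j^0}=1+\sigma\Delta t\frac{B_j^1}{B_j^0}\big(\sqrt2\,v_{j0}^1-2\big)$.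 The step is well-defined if such a solution exists (then $B_j^1\neq0$). Write $\mathbf v_0^1=(v_{j0}^1)_j\in\mathbb R^{N_x}$. 5. Transformation. $\mathbf K^{\ast,\mathrm{trans}}=\mathrm{diag}(B_j^0/B_j^1)\,\widehat{\widehat{\mathbf X}}{}^\ast\widehat{\widehat{\mathbf S}}{}^\ast$, with QR decomposition $\mathbf K^{\ast,\mathrm{trans}}=\widehat{\widehat{\mathbf X}}{}^{\ast,\mathrm{trans}}\widehat{\widehat{\mathbf S}}{}^{\ast,\mathrm{trans}}$. 6. Augmentation. $\widehat{\widehat{\mathbf X}}{}^1=\mathrm{qr}([\mathbf v_0^1,\widehat{\widehat{\mathbf X}}{}^{\ast,\mathrm{trans}}])$, $\widehat{\widehat{\mathbf V}}{}^1=\mathrm{qr}([\mathbf e_1,\widehat{\widehat{\mathbf V}}{}^\ast])$ and $\widehat{\widehat{\mathbf S}}{}^1=\widehat{\widehat{\mathbf X}}{}^{1,\top}\widehat{\widehat{\mathbf X}}{}^{\ast,\mathrm{trans}}\widehat{\widehat{\mathbf S}}{}^{\ast,\mathrm{trans}}\widehat{\widehat{\mathbf V}}{}^{\ast,\top}(\mathbf I-\mathbf e_1\mathbf e_1^\top)\widehat{\widehat{\mathbf V}}{}^1+\widehat{\widehat{\mathbf X}}{}^{1,\top}\mathbf v_0^1\mathbf e_1^\top\widehat{\widehat{\mathbf V}}{}^1\in\mathbb R^{(4r+1)\times(4r+1)}$. 7. Truncation with a tolerance $\vartheta\geq 0$, by either of the following. (i) Standard truncation: SVD $\widehat{\widehat{\mathbf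 S}}{}^1=\mathbf P\mathbf\Sigma\mathbf Q^\top$ with decreasingly ordered singular values $\sigma_j$; choose $r_1$ with $(\sum_{j>r_1}\sigma_j^2)^{1/2}\le\vartheta$; $\mathbf S^1$ is the diagonal matrix of the $r_1$ largest singular values, and $\mathbf X^1=\widehat{\widehat{\mathbf X}}{}^1\mathbf P^1$, $\mathbf V^1=\widehat{\widehat{\mathbf V}}{}^1\mathbf Q^1$ with $\mathbf P^1,\mathbf Q^1$ the first $r_1$ columns of $\mathbf P,\mathbf Q$. (ii) Conservative truncation: put $\widehat{\widehat{\mathbf K}}{}^1=\widehat{\widehat{\mathbf X}}{}^1\widehat{\widehat{\mathbf S}}{}^1=[\mathbf K^{\mathrm{cons}},\mathbf K^{\mathrm{rem}}]$ and $\widehat{\widehat{\mathbf V}}{}^1=[\mathbf e_1,\widehat{\widehat{\mathbf V}}{}^{\mathrm{rem}}]$ (first column, remaining columns). Set $\mathbf X^{\mathrm{cons}}=\mathbf K^{\mathrm{cons}}/\|\mathbf K^{\mathrm{cons}}\|$, $S^{\mathrm{cons}}=\|\mathbf K^{\mathrm{cons}}\|$ (any unit vector for $\mathbf X^{\mathrm{cons}}$ if $\mathbf K^{\mathrm{cons}}=0$). QR-decompose $\mathbf K^{\mathrm{rem}}=\widehat{\widehat{\mathbf X}}{}^{\mathrm{rem}}\widehat{\widehat{\mathbf S}}{}^{\mathrm{rem}}$, take the SVD $\widehat{\widehat{\mathbf S}}{}^{\mathrm{rem}}=\mathbf P\mathbf\Sigma\mathbf Q^\top$, choose $r_1\le4r$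 with $(\sum_{j=r_1+1}^{4r}\sigma_j^2)^{1/2}\le\vartheta$, let $\mathbf S^{\mathrm{rem}}$ be the diagonal matrix of the $r_1$ largest singular values, $\mathbf X^{\mathrm{rem}}=\widehat{\widehat{\mathbf X}}{}^{\mathrm{rem}}\mathbf P^{\mathrm{rem}}$, $\mathbf V^{\mathrm{rem}}=\widehat{\widehat{\mathbf V}}{}^{\mathrm{rem}}\mathbf Q^{\mathrm{rem}}$ with the first $r_1$ columns of $\mathbf P,\mathbf Q$. QR-decompose $[\mathbf X^{\mathrm{cons}},\mathbf X^{\mathrm{rem}}]=\mathbf X^1\mathbf R^1$ and $[\mathbf e_1,\mathbf V^{\mathrm{rem}}]=\mathbf V^1\mathbf R^2$ and set $\mathbf S^1=\mathbf R^1\begin{bmatrix}S^{\mathrm{cons}}&0\\0&\mathbf S^{\mathrm{rem}}\end{bmatrix}\mathbf R^{2,\top}$. The result of the step is $\mathbf B^1$ and $\mathbf v^1=\mathbf X^1\mathbf S^1\mathbf V^{1,\top}$. *)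

theory Defs
  imports
    "HOL-Analysis.Henstock_Kurzweil_Integration"
    "HOL-Computational_Algebra.Polynomial"
    "Jordan_Normal_Form.Matrix"
begin

unbundle no inner_syntax

text \<open>
  All vectors and matrices are those of \<^theory>\<open>Jordan_Normal_Form.Matrix\<close>: their dimensions are
  terms and their indices start at 0. The spatial index \<open>j \<in> {1..N\<^sub>x}\<close> is therefore shifted to
  \<open>{0..<N\<^sub>x}\<close>, whereas angular indices start at 0 anyway.
\<close>

section \<open>Linear algebra\<close>

definition append_cols :: "real mat \<Rightarrow> real mat \<Rightarrow> real mat" (infixr \<open>@\<^sub>c\<close> 65) where
  "A @\<^sub>c B = four_block_mat A B (0\<^sub>m 0 (dim_col A)) (0\<^sub>m 0 (dim_col B))"

definition take_cols :: "nat \<Rightarrow> real mat \<Rightarrow> real mat" where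
  "take_cols k A = mat_of_cols (dim_row A) (take k (cols A))"

definition drop_cols :: "nat \<Rightarrow> real mat \<Rightarrow> real mat" where
  "drop_cols k A = mat_of_cols (dim_row A) (drop k (cols A))"

definition col_mat :: "real vec \<Rightarrow> real mat" where
  "col_mat v = mat_of_cols (dim_vec v) [v]"

definition euclid_norm :: "real vec \<Rightarrow> real" where
  "euclid_norm v = sqrt (v \<bullet> v)"

definition mat_range :: "real mat \<Rightarrow> real vec set" where
  "mat_range Z = {Z *\<^sub>v x | x. x \<in> carrier_vec (dim_col Z)}"

definition orthonormal_cols :: "real mat \<Rightarrow> bool" where
  "orthonormal_cols Q \<longleftrightarrow> Q\<^sup>T * Q = 1\<^sub>m (dim_col Q)"

text \<open>
  \<open>is_qr Z Q\<close> says that \<open>Q\<close> is an admissible value of \<open>qr(Z)\<close>. This is a relation rather than a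
  function because \<open>Q\<close> is not determined by \<open>Z\<close>.
\<close>

definition is_qr :: "real mat \<Rightarrow> real mat \<Rightarrow> bool" where
  "is_qr Z Q \<longleftrightarrow>
     Q \<in> carrier_mat (dim_row Z) (dim_col Z) \<and> orthonormal_cols Q \<and> mat_range Z \<subseteq> mat_range Q \<and>
     (0 < dim_col Z \<and> col Z 0 \<noteq> 0\<^sub>v (dim_row Z) \<longrightarrow>
        col Q 0 = (1 / euclid_norm (col Z 0)) \<cdot>\<^sub>v col Z 0)"

definition is_qr_decomposition :: "real mat \<Rightarrow> real mat \<Rightarrow> real mat \<Rightarrow> bool" where
  "is_qr_decomposition Z Q R \<longleftrightarrow>
     Q \<in> carrier_mat (dim_row Z) (dim_col Z) \<and> R \<in> carrier_mat (dim_col Z) (dim_col Z) \<and>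
     orthonormal_cols Q \<and> upper_triangular R \<and> Z = Q * R"

definition is_svd :: "nat \<Rightarrow> real mat \<Rightarrow> real mat \<Rightarrow> real mat \<Rightarrow> real mat \<Rightarrow> bool" where
  "is_svd n S P \<Sigma> Q \<longleftrightarrow>
     P \<in> carrier_mat n n \<and> \<Sigma> \<in> carrier_mat n n \<and> Q \<in> carrier_mat n n \<and>
     orthonormal_cols P \<and> orthonormal_cols Q \<and> diagonal_mat \<Sigma> \<and>
     (\<forall>j<n. 0 \<le> \<Sigma> $$ (j,j)) \<and> (\<forall>i<n. \<forall>j<n. i \<le> j \<longrightarrow> \<Sigma> $$ (j,j) \<le> \<Sigma> $$ (i,i)) \<and>
     S = P * \<Sigma> * Q\<^sup>T"

definition is_eigen_decomposition :: "nat \<Rightarrow> real mat \<Rightarrow> real mat \<Rightarrow> real mat \<Rightarrow> bool" where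
  "is_eigen_decomposition n A Q M \<longleftrightarrow>
     Q \<in> carrier_mat n n \<and> M \<in> carrier_mat n n \<and>
     orthonormal_cols Q \<and> diagonal_mat M \<and> A = Q * M * Q\<^sup>T"

section \<open>Angular matrices\<close>

text \<open>The Legendre polynomials by Rodrigues' formula, scaled to unit norm in \<open>L\<^sup>2(-1,1)\<close>;
  \<open>normalized_legendre_orthonormal\<close> below confirms the scaling.\<close>

definition legendre :: "nat \<Rightarrow> real poly" where
  "legendre l = Polynomial.smult (1 / (2 ^ l * fact l)) ((pderiv ^^ l) ([:-1, 0, 1:] ^ l))"

definition normalized_legendre :: "nat \<Rightarrow> real poly" where
  "normalized_legendre l = Polynomial.smult (sqrt ((2 * real l + 1) / 2)) (legendre l)"

definition poly_integral :: "real poly \<Rightarrow> real" where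
  "poly_integral p = integral {-1..1} (poly p)"

lemma poly_integrable: "poly p integrable_on {-1..1::real}"
  by (intro integrable_continuous_real continuous_intros)

lemma poly_integral_pderiv: "poly_integral (pderiv p) = poly p 1 - poly p (-1)"
  unfolding poly_integral_def
  by (intro integral_unique fundamental_theorem_of_calculus)
    (auto simp: has_real_derivative_iff_has_vector_derivative[symmetric]
      intro!: DERIV_subset[OF poly_DERIV])

lemma poly_integral_add: "poly_integral (p + q) = poly_integral p + poly_integral q"
proof -
  have "poly (p + q) = (\<lambda>x. poly p x + poly q x)" by auto
  with integral_add[OF poly_integrable[of p] poly_integrable[of q]]
  show ?thesis by (simp only: poly_integral_def)
qed

lemma poly_integral_smult: "poly_integral (Polynomial.smult c p) = c * poly_integral p"
proof -
  have "poly (Polynomial.smult c p) = (\<lambda>x. c * poly p x)" by auto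
  then show ?thesis by (simp add: poly_integral_def)
qed

lemma poly_integral_0: "poly_integral 0 = 0"
  using poly_integral_smult[of 0 0] by simp

lemma poly_integral_by_parts:
  assumes "poly p 1 = 0" "poly p (-1) = (0::real)"
  shows "poly_integral ((pderiv p * q)) = - poly_integral ((p * pderiv q))"
proof -
  have "poly_integral ((p * pderiv q + pderiv p * q)) = 0"
    using poly_integral_pderiv[of "p * q"] assms by (simp add: pderiv_mult algebra_simps)
  then show ?thesis unfolding poly_integral_add by simp
qed

lemma dvd_higher_pderiv:
  "(w :: real poly) ^ (n - k) dvd (pderiv ^^ k) (w ^ n)" if "k \<le> n"
  using that
proof (induction k)
  case (Suc k)
  define m where "m = n - Suc k"
  have m: "n - k = Suc m" using Suc.prems by (simp add: m_def)
  from Suc obtain c where "(pderiv ^^ k) (w ^ n) = w ^ Suc m * c"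
    by (auto simp: m elim: dvdE)
  then have "(pderiv ^^ Suc k) (w ^ n) = pderiv (w ^ Suc m * c)" by simp
  also have "\<dots> = w ^ m * (w * pderiv c + of_nat (Suc m) * pderiv w * c)"
    by (simp only: pderiv_mult pderiv_power_Suc) (simp add: algebra_simps of_nat_poly)
  finally show ?case by (simp add: m_def)
qed simp

lemma integral_rodrigues:
  fixes n :: nat and q :: "real poly"
  defines "W \<equiv> [:-1, 0, 1:] ^ n"
  shows "poly_integral (((pderiv ^^ n) W * q)) =
    (-1) ^ n * poly_integral ((W * (pderiv ^^ n) q))"
proof -
  have "poly_integral (((pderiv ^^ n) W * q)) =
    (-1) ^ j * poly_integral (((pderiv ^^ (n - j)) W * (pderiv ^^ j) q))" if "j \<le> n" for j
    using that
  proof (induction j)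
    case (Suc j)
    define k where "k = n - Suc j"
    have k: "n - j = Suc k" "k < n" "n - k = Suc j" using Suc.prems by (auto simp: k_def)
    have "[:-1, 0, 1:] ^ Suc j dvd (pderiv ^^ k) W"
      using dvd_higher_pderiv[of k n "[:-1, 0, 1:]"] k by (simp add: W_def del: power_Suc)
    then obtain c where "(pderiv ^^ k) W = [:-1, 0, 1:] ^ Suc j * c" by (elim dvdE)
    then have z: "poly ((pderiv ^^ k) W) 1 = 0" "poly ((pderiv ^^ k) W) (-1) = 0" by auto
    show ?case
      using Suc poly_integral_by_parts[OF z, of "(pderiv ^^ j) q"] by (simp add: k flip: k_def)
  qed simp
  from this[of n] show ?thesis by simp
qed

lemma integral_rodrigues_weight:
  "(-1) ^ n * poly_integral (([:-1, 0, 1:] ^ n)) * fact (2 * n + 1) = (2 * 4 ^ n * (fact n)\<^sup>2 :: real)"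
proof (induction n)
  case (Suc n)
  let ?w = "[:-1, 0, 1:] :: real poly"
  let ?J = "\<lambda>n. poly_integral ((?w ^ n))"
  have "?J (Suc n) = - poly_integral ((pderiv (?w ^ Suc n) * [:0, 1:]))"
    using poly_integral_by_parts[of "?w ^ Suc n" "[:0, 1:]"]
    by (simp add: pderiv_pCons one_pCons del: power_Suc flip: one_pCons)
  also have "pderiv (?w ^ Suc n) * [:0, 1:] =
      Polynomial.smult (2 * real (Suc n)) (?w ^ Suc n + ?w ^ n)"
  proof -
    have "?w ^ Suc n + ?w ^ n = ?w ^ n * [:0, 0, 1:]"
      by (simp add: algebra_simps)
    then show ?thesis by (simp only: pderiv_power_Suc) (simp add: pderiv_pCons algebra_simps)
  qed
  finally have "(2 * real n + 3) * ?J (Suc n) = - 2 * real (Suc n) * ?J n"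
    unfolding poly_integral_smult poly_integral_add
    by (simp add: algebra_simps del: power_Suc mult_pCons_left mult_pCons_right)
  moreover have "(fact (2 * Suc n + 1) :: real) = (2 * real n + 3) * (2 * real (Suc n)) * fact (2 * n + 1)"
    by (simp add: algebra_simps)
  moreover have "- e * J1 * F1 = d\<^sup>2 * (e * J0 * F0)"
    if "c * J1 = - d * J0" "F1 = c * d * F0" for c d e J0 J1 F0 F1 :: real
  proof -
    have "- e * J1 * F1 = - e * d * F0 * (c * J1)" by (simp add: that(2))
    then show ?thesis by (simp add: that(1) power2_eq_square)
  qed
  ultimately have "- ((-1) ^ n) * ?J (Suc n) * fact (2 * Suc n + 1) =
      (2 * real (Suc n))\<^sup>2 * ((-1) ^ n * ?J n * fact (2 * n + 1))"
    unfolding mult_minus_left by blast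
  then have "(-1) ^ Suc n * ?J (Suc n) * fact (2 * Suc n + 1) =
      (2 * real (Suc n))\<^sup>2 * ((-1) ^ n * ?J n * fact (2 * n + 1))"
    by (simp only: power_Suc[of "-1 :: real"] mult_minus1)
  also have "\<dots> = 2 * 4 ^ Suc n * (fact (Suc n))\<^sup>2"
    unfolding Suc.IH by (simp add: power2_eq_square algebra_simps)
  finally show ?case .
next
  case 0
  have "pderiv [:0, 1:] = (1 :: real poly)" by (simp add: pderiv_pCons)
  then show ?case using poly_integral_pderiv[of "[:0, 1:]"] by simp
qed

lemma degree_rodrigues: "degree ((pderiv ^^ l) ([:-1, 0, 1:] ^ l) :: real poly) \<le> l"
proof -
  have "degree ((pderiv ^^ k) p) = degree p - k" for k and p :: "real poly"
    by (induction k) (auto simp: degree_pderiv)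
  then show ?thesis by (simp add: degree_power_eq)
qed

lemma higher_pderiv_eq_0:
  "(pderiv ^^ n) p = 0" if "degree p < n" for p :: "real poly"
  using that by (intro poly_eqI) (simp add: coeff_higher_pderiv coeff_eq_0)

lemma integral_legendre_less:
  "poly_integral ((legendre k * legendre l)) = 0" if "l < k"
proof -
  have "(pderiv ^^ k) (legendre l) = 0"
    using that degree_rodrigues[of l] by (intro higher_pderiv_eq_0) (simp add: legendre_def)
  then show ?thesis
    using integral_rodrigues[of k "legendre l"] by (simp add: legendre_def[of k] poly_integral_smult poly_integral_0)
qed

lemma integral_legendre_square:
  "poly_integral ((legendre n * legendre n)) = 2 / (2 * real n + 1)"
proof -
  let ?w = "[:-1, 0, 1:] :: real poly"
  let ?J = "poly_integral ((?w ^ n))"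
  have "(pderiv ^^ n) ((pderiv ^^ n) (?w ^ n)) = [:fact (2 * n):]"
  proof (intro poly_eqI)
    fix i
    have "lead_coeff (?w ^ n) = 1" by (simp add: lead_coeff_power)
    moreover have "degree (?w ^ n) = 2 * n" by (simp add: degree_power_eq)
    ultimately have "coeff (?w ^ n) (2 * n) = 1" by metis
    moreover have "(pderiv ^^ n) ((pderiv ^^ n) (?w ^ n)) = (pderiv ^^ (2 * n)) (?w ^ n)"
      by (simp add: mult_2 funpow_add)
    ultimately show "coeff ((pderiv ^^ n) ((pderiv ^^ n) (?w ^ n))) i = coeff [:fact (2 * n):] i"
      by (cases i) (auto simp: coeff_higher_pderiv pochhammer_fact coeff_eq_0 degree_power_eq)
  qed
  then have "poly_integral (((pderiv ^^ n) (?w ^ n) * (pderiv ^^ n) (?w ^ n))) =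
      (-1) ^ n * ?J * fact (2 * n)"
    using integral_rodrigues[of n "(pderiv ^^ n) (?w ^ n)"] by (simp add: poly_integral_smult)
  also have "\<dots> = 2 * 4 ^ n * (fact n)\<^sup>2 / (2 * real n + 1)"
    using integral_rodrigues_weight[of n] by (simp add: field_simps)
  finally show ?thesis
    by (simp add: legendre_def poly_integral_smult power2_eq_square field_simps flip: power_mult_distrib)
qed

lemma normalized_legendre_orthonormal:
  "integral {-1..1} (\<lambda>\<mu>. poly (normalized_legendre k) \<mu> * poly (normalized_legendre l) \<mu>) =
     (if k = l then 1 else 0)"
proof -
  have "poly_integral ((legendre k * legendre l)) = (if k = l then 2 / (2 * real k + 1) else 0)"
    using integral_legendre_less[of k l] integral_legendre_less[of l k] integral_legendre_square[of k]
    by (cases k l rule: linorder_cases) (auto simp: mult.commute)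
  moreover have "(\<lambda>\<mu>. poly (normalized_legendre k) \<mu> * poly (normalized_legendre l) \<mu>) =
      poly (Polynomial.smult (sqrt ((2 * real k + 1) / 2) * sqrt ((2 * real l + 1) / 2)) (legendre k * legendre l))"
    by (simp add: fun_eq_iff normalized_legendre_def)
  ultimately show ?thesis
    by (simp add: poly_integral_smult flip: poly_integral_def)
qed

definition angular_matrix :: "nat \<Rightarrow> real mat" where
  "angular_matrix N = mat N N (\<lambda>(k,l).
     integral {-1..1} (\<lambda>\<mu>. \<mu> * poly (normalized_legendre k) \<mu> * poly (normalized_legendre l) \<mu>))"

section \<open>Stencil matrices\<close>

text \<open>Periodic stencils; for \<open>N \<ge> 3\<close> the cases below are mutually exclusive.\<close>

definition Dx_mat :: "nat \<Rightarrow> real \<Rightarrow> real mat" where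
  "Dx_mat N dx = mat N N (\<lambda>(i,j).
     if j = (i + 1) mod N then 1 / (2 * dx)
     else if i = (j + 1) mod N then - 1 / (2 * dx) else 0)"

definition Dxx_mat :: "nat \<Rightarrow> real \<Rightarrow> real mat" where
  "Dxx_mat N dx = mat N N (\<lambda>(i,j).
     if j = i then - 1 / dx
     else if j = (i + 1) mod N \<or> i = (j + 1) mod N then 1 / (2 * dx) else 0)"

text \<open>\<open>diag(B)\<^sup>-\<^sup>1 D diag(B)\<close>, for \<open>B\<close> without zero entries\<close>

definition conj_diag :: "real vec \<Rightarrow> real mat \<Rightarrow> real mat" where
  "conj_diag B D = mat_diag (dim_vec B) (\<lambda>j. 1 / B $ j) * D * mat_diag (dim_vec B) (\<lambda>j. B $ j)"

section \<open>One step of the scheme\<close>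

definition K_step ::
  "real \<Rightarrow> real \<Rightarrow> real mat \<Rightarrow> real mat \<Rightarrow> real mat \<Rightarrow> real mat \<Rightarrow> real mat \<Rightarrow> real mat \<Rightarrow> real mat \<Rightarrow> real mat"
where
  "K_step dt \<sigma> Gx Gxx A absA X0 S0 V0 =
     (let K0 = X0 * S0 in
      (1 / (1 + \<sigma> * dt)) \<cdot>\<^sub>m
        (K0 - dt \<cdot>\<^sub>m (Gx * K0 * V0\<^sup>T * A * V0) + dt \<cdot>\<^sub>m (Gxx * K0 * V0\<^sup>T * absA * V0)))"

definition L_step ::
  "real \<Rightarrow> real \<Rightarrow> real mat \<Rightarrow> real mat \<Rightarrow> real mat \<Rightarrow> real mat \<Rightarrow> real mat \<Rightarrow> real mat \<Rightarrow> real mat \<Rightarrow> real mat"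
where
  "L_step dt \<sigma> Gx Gxx A absA X0 S0 V0 =
     (let L0 = V0 * S0\<^sup>T in
      (1 / (1 + \<sigma> * dt)) \<cdot>\<^sub>m
        (L0 - dt \<cdot>\<^sub>m (A * L0 * X0\<^sup>T * Gx\<^sup>T * X0) + dt \<cdot>\<^sub>m (absA * L0 * X0\<^sup>T * Gxx\<^sup>T * X0)))"

text \<open>From here on, \<open>Xs\<close>, \<open>Vs\<close>, \<open>Ss\<close> are the twice augmented bases and coefficients
  (double hat, star), and \<open>St\<close> is the projection of \<open>S0\<close> onto these bases.\<close>

definition projected_S0 :: "real mat \<Rightarrow> real mat \<Rightarrow> real mat \<Rightarrow> real mat \<Rightarrow> real mat \<Rightarrow> real mat" where
  "projected_S0 X0 S0 V0 Xs Vs = (Xs\<^sup>T * X0) * S0 * (Vs\<^sup>T * V0)\<^sup>T"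

definition S_step ::
  "real \<Rightarrow> real \<Rightarrow> real mat \<Rightarrow> real mat \<Rightarrow> real mat \<Rightarrow> real mat \<Rightarrow> real mat \<Rightarrow> real mat \<Rightarrow> real mat \<Rightarrow> real mat"
where
  "S_step dt \<sigma> Gx Gxx A absA Xs Vs St =
     (1 / (1 + \<sigma> * dt)) \<cdot>\<^sub>m
       (St - dt \<cdot>\<^sub>m (Xs\<^sup>T * Gx * Xs * St * Vs\<^sup>T * A * Vs)
           + dt \<cdot>\<^sub>m (Xs\<^sup>T * Gxx * Xs * St * Vs\<^sup>T * absA * Vs))"

definition coupled_update ::
  "real \<Rightarrow> real \<Rightarrow> real mat \<Rightarrow> real mat \<Rightarrow> real mat \<Rightarrow> real mat \<Rightarrow> real vec \<Rightarrow> real mat \<Rightarrow>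
   real mat \<Rightarrow> real mat \<Rightarrow> real mat \<Rightarrow> real vec \<Rightarrow> real vec \<Rightarrow> bool"
where
  "coupled_update dt \<sigma> Gx Gxx A absA B0 v0 Xs St Vs B1 v01 \<longleftrightarrow>
     B1 \<in> carrier_vec (dim_vec B0) \<and> v01 \<in> carrier_vec (dim_vec B0) \<and>
     (\<forall>j<dim_vec B0.
        B1 $ j / B0 $ j * v01 $ j =
          1 / (1 + \<sigma> * dt) *
            (v0 $$ (j,0)
             - dt * (Gx * Xs * St * Vs\<^sup>T * A) $$ (j,0)
             + dt * (Gxx * Xs * St * Vs\<^sup>T * absA) $$ (j,0)
             + sqrt 2 * \<sigma> * dt * (B1 $ j / B0 $ j)) \<and>
        B1 $ j / B0 $ j = 1 + \<sigma> * dt * (B1 $ j / B0 $ j) * (sqrt 2 * v01 $ j - 2))"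

definition augmented_S ::
  "real mat \<Rightarrow> real mat \<Rightarrow> real mat \<Rightarrow> real vec \<Rightarrow> real mat \<Rightarrow> real mat \<Rightarrow> real mat"
where
  "augmented_S Xtr Str Vs v01 Xa Va =
     (let e1 = col_mat (unit_vec (dim_row Vs) 0) in
      Xa\<^sup>T * Xtr * Str * Vs\<^sup>T * (1\<^sub>m (dim_row Vs) - e1 * e1\<^sup>T) * Va
      + Xa\<^sup>T * col_mat v01 * e1\<^sup>T * Va)"

text \<open>The truncations relate the augmented factors \<open>Xa\<close>, \<open>Sa\<close>, \<open>Va\<close> to the new ones.\<close>

definition standard_truncation ::
  "real \<Rightarrow> real mat \<Rightarrow> real mat \<Rightarrow> real mat \<Rightarrow> real mat \<Rightarrow> real mat \<Rightarrow> real mat \<Rightarrow> bool"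
where
  "standard_truncation \<theta> Xa Sa Va X1 S1 V1 \<longleftrightarrow>
     (\<exists>P \<Sigma> Q r1.
        is_svd (dim_row Sa) Sa P \<Sigma> Q \<and> r1 \<le> dim_row Sa \<and>
        sqrt (\<Sum>j=r1..<dim_row Sa. (\<Sigma> $$ (j,j))\<^sup>2) \<le> \<theta> \<and>
        S1 = mat_diag r1 (\<lambda>j. \<Sigma> $$ (j,j)) \<and>
        X1 = Xa * take_cols r1 P \<and> V1 = Va * take_cols r1 Q)"

definition conservative_truncation ::
  "real \<Rightarrow> real mat \<Rightarrow> real mat \<Rightarrow> real mat \<Rightarrow> real mat \<Rightarrow> real mat \<Rightarrow> real mat \<Rightarrow> bool"
where
  "conservative_truncation \<theta> Xa Sa Va X1 S1 V1 \<longleftrightarrow>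
     (let Ka = Xa * Sa; Kcons = col Ka 0; Krem = drop_cols 1 Ka; m = dim_col Krem;
          e1 = col_mat (unit_vec (dim_row Va) 0); Varem = drop_cols 1 Va in
      \<exists>Xcons Xarem Sarem P \<Sigma> Q r1 R1 R2.
        Xcons \<in> carrier_vec (dim_row Ka) \<and> euclid_norm Xcons = 1 \<and>
        (Kcons \<noteq> 0\<^sub>v (dim_row Ka) \<longrightarrow> Xcons = (1 / euclid_norm Kcons) \<cdot>\<^sub>v Kcons) \<and>
        is_qr_decomposition Krem Xarem Sarem \<and>
        is_svd m Sarem P \<Sigma> Q \<and> r1 \<le> m \<and>
        sqrt (\<Sum>j=r1..<m. (\<Sigma> $$ (j,j))\<^sup>2) \<le> \<theta> \<and>
        is_qr_decomposition (col_mat Xcons @\<^sub>c (Xarem * take_cols r1 P)) X1 R1 \<and>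
        is_qr_decomposition (e1 @\<^sub>c (Varem * take_cols r1 Q)) V1 R2 \<and>
        S1 = R1 * four_block_mat (mat 1 1 (\<lambda>_. euclid_norm Kcons)) (0\<^sub>m 1 r1)
                    (0\<^sub>m r1 1) (mat_diag r1 (\<lambda>j. \<Sigma> $$ (j,j))) * R2\<^sup>T)"

text \<open>
  \<open>dlra_step \<dots> B1 X1 S1 V1\<close> says that \<open>B1\<close> and \<open>X1 S1 V1\<^sup>T\<close> are a possible result of one
  step with spatial mesh width \<open>dx\<close>, step size \<open>dt\<close>, opacity \<open>\<sigma>\<close> and tolerance \<open>\<theta>\<close>, for some choice
  of the orthonormal bases, of the solution of the coupled system, of the decompositions, of the
  truncated rank and of the kind of truncation.
\<close>

definition dlra_step ::
  "real \<Rightarrow> real \<Rightarrow> real \<Rightarrow> real \<Rightarrow> real mat \<Rightarrow> real mat \<Rightarrow>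
   real vec \<Rightarrow> real mat \<Rightarrow> real mat \<Rightarrow> real mat \<Rightarrow>
   real vec \<Rightarrow> real mat \<Rightarrow> real mat \<Rightarrow> real mat \<Rightarrow> bool"
where
  "dlra_step dx dt \<sigma> \<theta> A absA B0 X0 S0 V0 B1 X1 S1 V1 \<longleftrightarrow>
     (let Nx = dim_vec B0;
          Gx = conj_diag B0 (Dx_mat Nx dx); Gxx = conj_diag B0 (Dxx_mat Nx dx) in
      \<exists>Xh Xs Vh Vs v01 Xtr Str Xa Va.
        is_qr (K_step dt \<sigma> Gx Gxx A absA X0 S0 V0 @\<^sub>c X0) Xh \<and>
        is_qr (Xh @\<^sub>c (Gx * X0) @\<^sub>c (Gxx * X0)) Xs \<and>
        is_qr (L_step dt \<sigma> Gx Gxx A absA X0 S0 V0 @\<^sub>c V0) Vh \<and>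
        is_qr (Vh @\<^sub>c (A\<^sup>T * V0) @\<^sub>c (absA\<^sup>T * V0)) Vs \<and>
        (let St = projected_S0 X0 S0 V0 Xs Vs; Ss = S_step dt \<sigma> Gx Gxx A absA Xs Vs St in
          coupled_update dt \<sigma> Gx Gxx A absA B0 (X0 * S0 * V0\<^sup>T) Xs St Vs B1 v01 \<and>
          is_qr_decomposition (mat_diag Nx (\<lambda>j. B0 $ j / B1 $ j) * Xs * Ss) Xtr Str \<and>
          is_qr (col_mat v01 @\<^sub>c Xtr) Xa \<and>
          is_qr (col_mat (unit_vec (dim_row Vs) 0) @\<^sub>c Vs) Va \<and>
          (let Sa = augmented_S Xtr Str Vs v01 Xa Va in
            standard_truncation \<theta> Xa Sa Va X1 S1 V1 \<or>
            conservative_truncation \<theta> Xa Sa Va X1 S1 V1)))"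

section \<open>Energy\<close>

definition energy :: "real vec \<Rightarrow> real mat \<Rightarrow> real" where
  "energy B v =
     1/2 * (\<Sum>j<dim_vec B. \<Sum>k<dim_col v. (B $ j * v $$ (j,k))\<^sup>2) + 1/2 * (\<Sum>j<dim_vec B. (B $ j)\<^sup>2)"

end

theory Submission
  imports Defs "Jordan_Normal_Form.Determinant"
begin

text \<open>
  With \<open>U = diag(B\<^sup>0) v\<^sup>0\<close>, diagonalizing \<open>A\<close> decouples the flux update
  \<open>Y = U - \<Delta>t D\<^sup>x U A + \<Delta>t D\<^sup>x\<^sup>x U |A|\<close> into scalar upwind steps. The eigenvalues of
  \<open>A\<close> lie in \<open>[-1,1]\<close>, because \<open>x\<^sup>T A x = \<integral> \<mu> p(\<mu>)\<^sup>2\<close> with \<open>p = \<Sum> x\<^sub>k P\<^sub>k\<close>; hence for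
  \<open>\<Delta>t \<le> \<Delta>x\<close> each of these steps forms convex combinations of neighbouring values and
  \<open>\<parallel>Y\<parallel> \<le> \<parallel>U\<parallel>\<close>. The augmented bases contain everything needed to represent \<open>Y\<close> exactly. The
  implicit coupling of the zeroth moment with the internal energy only dissipates, and a
  truncation acts on the angular index as an orthogonal projection, up to an isometry.
\<close>

section \<open>Matrix algebra and the Frobenius norm\<close>

text \<open>Side conditions are equations between dimensions rather than carrier memberships, so
  that rewriting can discharge them without naming the sizes. The next rules follow the same
  pattern.\<close>

lemma mult_mat_assoc:
  fixes A B C :: "'a :: semiring_0 mat"
  assumes "dim_col A = dim_row B" "dim_col B = dim_row C"
  shows "A * B * C = A * (B * C)"
  using assms by (intro assoc_mult_mat[of _ "dim_row A" "dim_col A" _ "dim_col B" _ "dim_col C"]) auto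

lemma transpose_mult_mat:
  fixes A B :: "'a :: comm_semiring_0 mat"
  assumes "dim_col A = dim_row B"
  shows "(A * B)\<^sup>T = B\<^sup>T * A\<^sup>T"
  using assms by (intro transpose_mult[of _ "dim_row A" "dim_col A" _ "dim_col B"]) auto

lemma mult_mat_distrib:
  fixes A B C :: "real mat"
  assumes "dim_row A = dim_row B" "dim_col A = dim_col B" "dim_col A = dim_row C"
  shows "(A + B) * C = A * C + B * C" "(A - B) * C = A * C - B * C"
  using assms
  by (auto intro!: add_mult_distrib_mat[of _ "dim_row A" "dim_col A" _ _ "dim_col C"]
      minus_mult_distrib_mat[of _ "dim_row A" "dim_col A" _ _ "dim_col C"])

lemma mult_mat_distrib':
  fixes A B C :: "real mat"
  assumes "dim_row A = dim_row B" "dim_col A = dim_col B" "dim_col C = dim_row A"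
  shows "C * (A + B) = C * A + C * B" "C * (A - B) = C * A - C * B"
  using assms
  by (auto intro!: mult_add_distrib_mat[of _ "dim_row C" "dim_row A" _ "dim_col A"]
      mult_minus_distrib_mat[of _ "dim_row C" "dim_row A" _ "dim_col A"])

lemma mult_smult_mat:
  fixes A B :: "real mat"
  assumes "dim_col A = dim_row B"
  shows "(c \<cdot>\<^sub>m A) * B = c \<cdot>\<^sub>m (A * B)" "A * (c \<cdot>\<^sub>m B) = c \<cdot>\<^sub>m (A * B)"
  using assms
  by (auto intro!: mult_smult_assoc_mat[of _ "dim_row A" "dim_col A" _ "dim_col B"]
      mult_smult_distrib[of _ "dim_row A" "dim_col A" _ "dim_col B"])

text \<open>Products get associated to the right, which buries \<open>A * B\<close> inside
  \<open>A * (B * C)\<close>. In this form orthonormality still cancels there.\<close>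

lemma mult_mat_cancel_left:
  fixes A B C :: "'a :: semiring_1 mat"
  assumes "A * B = 1\<^sub>m n" "dim_col A = dim_row B" "dim_col B = dim_row C"
  shows "A * (B * C) = C"
proof -
  have "dim_col B = n" using arg_cong[OF assms(1), of dim_col] by simp
  then show ?thesis using assms mult_mat_assoc[of A B C] by simp
qed

definition sqnorm :: "real mat \<Rightarrow> real" where
  "sqnorm M = (\<Sum>j<dim_row M. \<Sum>k<dim_col M. (M $$ (j,k))\<^sup>2)"

lemma sqnorm_nonneg: "0 \<le> sqnorm M"
  by (simp add: sqnorm_def sum_nonneg)

text \<open>This is the trace of \<open>M * M\<^sup>T\<close>. Norm comparisons thereby become
  algebra with that product.\<close>

lemma sqnorm_eq_diag: "sqnorm M = (\<Sum>j<dim_row M. (M * M\<^sup>T) $$ (j,j))"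
  by (simp add: sqnorm_def scalar_prod_def power2_eq_square atLeast0LessThan)

lemma sqnorm_mult_transpose:
  assumes "orthonormal_cols W" "dim_col M = dim_col W"
  shows "sqnorm (M * W\<^sup>T) = sqnorm M"
proof -
  have "(M * W\<^sup>T) * (M * W\<^sup>T)\<^sup>T = M * M\<^sup>T"
    using assms
    by (simp add: transpose_mult_mat mult_mat_assoc orthonormal_cols_def mult_mat_cancel_left)
  then show ?thesis by (simp add: sqnorm_eq_diag del: index_mult_mat(1))
qed

text \<open>Pythagoras: the residual \<open>R = M - M * (W * W\<^sup>T)\<close> has rows orthogonal
  to the columns of \<open>W\<close>, so its squared norm is exactly the difference of the two
  sides.\<close>

lemma sqnorm_mult_le:
  assumes W: "orthonormal_cols W" and dim: "dim_col M = dim_row W"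
  shows "sqnorm (M * W) \<le> sqnorm M"
proof -
  define R where "R = M - M * (W * W\<^sup>T)"
  have RW: "R * W = 0\<^sub>m (dim_row M) (dim_col W)"
  proof -
    have "R * W = M * W - M * (W * W\<^sup>T) * W" unfolding R_def
      using dim by (intro minus_mult_distrib_mat[of _ "dim_row M" "dim_col M" _ _ "dim_col W"]) auto
    also have "M * (W * W\<^sup>T) * W = M * W"
      using W dim by (simp add: mult_mat_assoc orthonormal_cols_def)
    finally show ?thesis by auto
  qed
  have R: "dim_row R = dim_row M" "dim_col R = dim_col M" using dim by (simp_all add: R_def)
  have "R\<^sup>T = M\<^sup>T - W * W\<^sup>T * M\<^sup>T"
    unfolding R_def using dim
    by (subst transpose_minus[of _ "dim_row M" "dim_col M"]) (auto simp: transpose_mult_mat)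
  then have "R * R\<^sup>T = R * M\<^sup>T - R * (W * W\<^sup>T * M\<^sup>T)"
    using dim R by (simp add: mult_mat_distrib')
  also have "R * (W * W\<^sup>T * M\<^sup>T) = 0\<^sub>m (dim_row M) (dim_row M)"
  proof -
    have "R * (W * W\<^sup>T * M\<^sup>T) = R * W * (W\<^sup>T * M\<^sup>T)"
      using dim by (simp add: mult_mat_assoc R_def)
    then show ?thesis using dim by (simp add: RW)
  qed
  also have "R * M\<^sup>T = M * M\<^sup>T - (M * W) * (M * W)\<^sup>T"
    unfolding R_def using dim by (simp add: mult_mat_distrib transpose_mult_mat mult_mat_assoc)
  finally have *: "R * R\<^sup>T = M * M\<^sup>T - (M * W) * (M * W)\<^sup>T - 0\<^sub>m (dim_row M) (dim_row M)" .
  have "0 \<le> sqnorm R" by (rule sqnorm_nonneg)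
  also have "sqnorm R = sqnorm M - sqnorm (M * W)"
    unfolding sqnorm_eq_diag * using dim by (simp add: R_def sum_subtractf del: index_mult_mat(1))
  finally show ?thesis by simp
qed

lemma orthonormal_cols_square_transpose:
  assumes "Q \<in> carrier_mat n n" "orthonormal_cols Q"
  shows "orthonormal_cols (Q\<^sup>T)"
proof -
  have "Q * Q\<^sup>T = 1\<^sub>m n"
    using assms by (intro mat_mult_left_right_inverse[of "Q\<^sup>T"]) (auto simp: orthonormal_cols_def)
  then show ?thesis using assms by (simp add: orthonormal_cols_def)
qed

lemma col_mult_dim:
  assumes "dim_col A = dim_row B" "j < dim_col B"
  shows "col (A * B) j = A *\<^sub>v col B j"
  using assms by (intro eq_vecI) auto

section \<open>Ranges and blocks of columns\<close>

text \<open>Each column of \<open>Z\<close> is \<open>Q *\<^sub>v x\<close> for some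
  \<open>x\<close>, and \<open>Q\<^sup>T * Q\<close> is the identity. It is in this form that range
  inclusions enter all later computations.\<close>

lemma orthonormal_projection:
  assumes Q: "orthonormal_cols Q" and sub: "mat_range Z \<subseteq> mat_range Q" and dim: "dim_row Z = dim_row Q"
  shows "Q * (Q\<^sup>T * Z) = Z"
proof (rule mat_col_eqI)
  fix j assume j: "j < dim_col Z"
  have "col Z j = Z *\<^sub>v unit_vec (dim_col Z) j"
    using j by (intro eq_vecI) auto
  then have "col Z j \<in> mat_range Z"
    unfolding mat_range_def by auto
  then obtain x where x: "x \<in> carrier_vec (dim_col Q)" "col Z j = Q *\<^sub>v x"
    using sub by (auto simp: mat_range_def)
  have "col (Q * (Q\<^sup>T * Z)) j = Q *\<^sub>v (Q\<^sup>T *\<^sub>v (Q *\<^sub>v x))"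
    using j dim by (simp add: col_mult_dim flip: x(2))
  also have "Q\<^sup>T *\<^sub>v (Q *\<^sub>v x) = x"
    using Q x by (subst assoc_mult_mat_vec[symmetric, of _ "dim_col Q" "dim_row Q" _ "dim_col Q"])
      (auto simp: orthonormal_cols_def)
  finally show "col (Q * (Q\<^sup>T * Z)) j = col Z j" by (simp add: x(2))
qed (use dim in auto)

lemma append_cols_dim [simp]:
  "dim_row (A @\<^sub>c B) = dim_row A" "dim_col (A @\<^sub>c B) = dim_col A + dim_col B"
  by (simp_all add: append_cols_def)

lemma col_mat_dim [simp]: "dim_row (col_mat v) = dim_vec v" "dim_col (col_mat v) = 1"
  by (simp_all add: col_mat_def)

lemma col_mat_index [simp]: "i < dim_vec v \<Longrightarrow> col_mat v $$ (i, 0) = v $ i"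
  by (simp add: col_mat_def mat_of_cols_def)

lemma take_cols_dim [simp]:
  "dim_row (take_cols r A) = dim_row A" "r \<le> dim_col A \<Longrightarrow> dim_col (take_cols r A) = r"
  by (simp_all add: take_cols_def)

lemma take_cols_index [simp]:
  "r \<le> dim_col A \<Longrightarrow> i < dim_row A \<Longrightarrow> j < r \<Longrightarrow> take_cols r A $$ (i, j) = A $$ (i, j)"
  by (simp add: take_cols_def mat_of_cols_def)

lemma drop_cols_dim [simp]:
  "dim_row (drop_cols r A) = dim_row A" "dim_col (drop_cols r A) = dim_col A - r"
  by (simp_all add: drop_cols_def)

lemma drop_cols_index [simp]:
  "i < dim_row A \<Longrightarrow> j < dim_col A - r \<Longrightarrow> drop_cols r A $$ (i, j) = A $$ (i, r + j)"
  by (simp add: drop_cols_def mat_of_cols_def)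

lemma append_cols_index:
  assumes "dim_row A = dim_row B" "i < dim_row A" "j < dim_col A + dim_col B"
  shows "(A @\<^sub>c B) $$ (i, j) = (if j < dim_col A then A $$ (i, j) else B $$ (i, j - dim_col A))"
  using assms by (simp add: append_cols_def)

lemma append_cols_mult_block:
  assumes "dim_row A = dim_row B" "dim_row C = dim_col A" "dim_row D = dim_col B"
  shows "(A @\<^sub>c B) * four_block_mat C (0\<^sub>m (dim_row C) (dim_col D)) (0\<^sub>m (dim_row D) (dim_col C)) D
    = (A * C) @\<^sub>c (B * D)"
  unfolding append_cols_def using assms
  by (subst mult_four_block_mat[of _ "dim_row A" "dim_col A" _ "dim_col B" _ 0 _ _ "dim_col C" _ "dim_col D"])
    auto

lemma append_cols_split_first:
  assumes "0 < dim_col A"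
  shows "A = col_mat (col A 0) @\<^sub>c drop_cols 1 A"
  using assms by (intro eq_matI) (auto simp: append_cols_index)

lemma mat_range_append_cols1:
  assumes "dim_row A = dim_row B"
  shows "mat_range A \<subseteq> mat_range (A @\<^sub>c B)"
proof
  fix v assume "v \<in> mat_range A"
  then obtain x where x: "x \<in> carrier_vec (dim_col A)" "v = A *\<^sub>v x" by (auto simp: mat_range_def)
  \<comment> \<open>The appended \<open>0\<^sub>v 0\<close> is the contribution of the lower blocks,
    which have no rows.\<close>
  have "(A @\<^sub>c B) *\<^sub>v (x @\<^sub>v 0\<^sub>v (dim_col B)) = v @\<^sub>v 0\<^sub>v 0"
    unfolding append_cols_def using assms x
    by (subst four_block_mat_mult_vec[of _ "dim_row A" "dim_col A" _ "dim_col B" _ 0]) auto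
  also have "v @\<^sub>v 0\<^sub>v 0 = v" by (intro eq_vecI) auto
  finally show "v \<in> mat_range (A @\<^sub>c B)"
    unfolding mat_range_def using x by (auto intro!: exI[of _ "x @\<^sub>v 0\<^sub>v (dim_col B)"])
qed

lemma mat_range_append_cols2:
  assumes "dim_row A = dim_row B"
  shows "mat_range B \<subseteq> mat_range (A @\<^sub>c B)"
proof
  fix v assume "v \<in> mat_range B"
  then obtain x where x: "x \<in> carrier_vec (dim_col B)" "v = B *\<^sub>v x" by (auto simp: mat_range_def)
  have "(A @\<^sub>c B) *\<^sub>v (0\<^sub>v (dim_col A) @\<^sub>v x) = v @\<^sub>v 0\<^sub>v 0"
    unfolding append_cols_def using assms x
    by (subst four_block_mat_mult_vec[of _ "dim_row A" "dim_col A" _ "dim_col B" _ 0]) auto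
  also have "v @\<^sub>v 0\<^sub>v 0 = v" by (intro eq_vecI) auto
  finally show "v \<in> mat_range (A @\<^sub>c B)"
    unfolding mat_range_def using x by (auto intro!: exI[of _ "0\<^sub>v (dim_col A) @\<^sub>v x"])
qed

section \<open>Diagonal matrices and truncated singular value decompositions\<close>

lemma diagonal_mat_eq_mat_diag:
  assumes "D \<in> carrier_mat n n" "diagonal_mat D"
  shows "D = mat_diag n (\<lambda>j. D $$ (j,j))"
  using assms by (intro eq_matI) (auto simp: mat_diag_def diagonal_mat_def)

lemma orthonormal_take_cols:
  assumes "orthonormal_cols Q" "r \<le> dim_col Q"
  shows "orthonormal_cols (take_cols r Q)"
proof -
  have "((take_cols r Q)\<^sup>T * take_cols r Q) $$ (i,j) = (Q\<^sup>T * Q) $$ (i,j)" if "i < r" "j < r" for i j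
    using that assms(2) by (simp add: scalar_prod_def)
  then show ?thesis
    using assms unfolding orthonormal_cols_def by (intro eq_matI) (auto simp del: index_mult_mat(1))
qed

text \<open>Orthonormality of \<open>Q\<close> gives \<open>S * Q = P * \<Sigma>\<close>, of which
  the first \<open>r\<close> columns are compared. Read from right to left it expresses the retained
  left factor through \<open>S\<close>, which turns truncation into a projection on the angular
  side.\<close>

lemma svd_mult_take_cols:
  assumes svd: "is_svd n S P \<Sigma> Q" and r: "r \<le> n"
  shows "S * take_cols r Q = take_cols r P * mat_diag r (\<lambda>j. \<Sigma> $$ (j,j))"
proof -
  have c: "P \<in> carrier_mat n n" "\<Sigma> \<in> carrier_mat n n" "Q \<in> carrier_mat n n" "orthonormal_cols Q"
    and d: "\<Sigma> = mat_diag n (\<lambda>j. \<Sigma> $$ (j,j))" and S: "S = P * \<Sigma> * Q\<^sup>T"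
    using svd diagonal_mat_eq_mat_diag by (auto simp: is_svd_def)
  have "S * Q = P * \<Sigma>"
    using c by (simp add: S mult_mat_assoc orthonormal_cols_def)
  also have "\<dots> = Matrix.mat n n (\<lambda>(i,j). P $$ (i,j) * \<Sigma> $$ (j,j))"
    using c by (subst d) (simp add: mat_diag_mult_right[of _ n])
  finally have *: "(S * Q) $$ (i,j) = P $$ (i,j) * \<Sigma> $$ (j,j)" if "i < n" "j < n" for i j
    using that by simp
  have "(S * take_cols r Q) $$ (i,j) = (S * Q) $$ (i,j)" if "i < n" "j < r" for i j
    using that c r by (simp add: scalar_prod_def S)
  then show ?thesis
    using r c * by (subst mat_diag_mult_right[of _ n])
      (auto intro!: eq_matI simp: S simp del: index_mult_mat(1))
qed

text \<open>Shape of the projection in the conservative truncation: the leading identity block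
  protects the zeroth moment, and \<open>J\<close> acts on the rest.\<close>

lemma orthonormal_block:
  assumes "orthonormal_cols J"
  shows "orthonormal_cols (four_block_mat (1\<^sub>m 1) (0\<^sub>m 1 (dim_col J)) (0\<^sub>m (dim_row J) 1) J)"
  unfolding orthonormal_cols_def using assms
  by (subst transpose_four_block_mat[of _ 1 1 _ "dim_col J" _ "dim_row J"], simp_all,
      subst mult_four_block_mat[of _ 1 1 _ "dim_row J" _ "dim_col J" _ _ 1 _ "dim_col J"])
    (auto simp: orthonormal_cols_def)

section \<open>Spectrum of the angular matrix\<close>

lemma smult_sum_right: "Polynomial.smult c (\<Sum>i\<in>I. f i) = (\<Sum>i\<in>I. Polynomial.smult c (f i))"
  for c :: "'a :: comm_semiring_0"
  by (intro poly_eqI) (simp add: coeff_sum sum_distrib_left)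

lemma poly_integral_sum: "poly_integral (\<Sum>i\<in>I. f i) = (\<Sum>i\<in>I. poly_integral (f i))"
  by (induction I rule: infinite_finite_induct) (simp_all add: poly_integral_0 poly_integral_add)

lemma poly_integral_mono:
  assumes "\<And>x. x \<in> {-1..1} \<Longrightarrow> poly p x \<le> poly q x"
  shows "poly_integral p \<le> poly_integral q"
  unfolding poly_integral_def using assms by (intro integral_le poly_integrable)

text \<open>The weight \<open>w\<close> is general because two instances are needed:
  \<open>[:0, 1:]\<close> yields the quadratic form of the angular matrix, and \<open>1\<close> that
  of the Gram matrix.\<close>

lemma poly_integral_quadratic_form:
  "poly_integral (w * (\<Sum>i\<in>I. Polynomial.smult (c i) (f i)) * (\<Sum>i\<in>I. Polynomial.smult (c i) (f i)))
    = (\<Sum>i\<in>I. \<Sum>l\<in>I. c i * poly_integral (w * f i * f l) * c l)"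
proof -
  have "w * (\<Sum>i\<in>I. Polynomial.smult (c i) (f i)) * (\<Sum>l\<in>I. Polynomial.smult (c l) (f l))
      = (\<Sum>i\<in>I. \<Sum>l\<in>I. Polynomial.smult (c i * c l) (w * f i * f l))"
    by (simp add: sum_distrib_left sum_distrib_right smult_sum_right mult_ac)
  then show ?thesis
    by (simp add: poly_integral_sum poly_integral_smult mult_ac)
qed

lemma angular_matrix_eq:
  "angular_matrix N = Matrix.mat N N (\<lambda>(k,l).
    poly_integral ([:0, 1:] * normalized_legendre k * normalized_legendre l))"
proof -
  have "(\<lambda>\<mu>. \<mu> * poly (normalized_legendre k) \<mu> * poly (normalized_legendre l) \<mu>) =
      poly ([:0, 1:] * normalized_legendre k * normalized_legendre l)" for k l
    by (auto simp: fun_eq_iff algebra_simps)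
  then show ?thesis by (simp add: angular_matrix_def poly_integral_def)
qed

lemma quadratic_form_index:
  fixes A Q :: "real mat"
  assumes "A \<in> carrier_mat n n" "Q \<in> carrier_mat n m" "k < m"
  shows "(Q\<^sup>T * A * Q) $$ (k,k) = (\<Sum>i<n. \<Sum>l<n. Q $$ (i,k) * A $$ (i,l) * Q $$ (l,k))"
  using assms
  by (simp add: scalar_prod_def atLeast0LessThan sum_distrib_left mult.assoc)

text \<open>A Rayleigh quotient: column \<open>k\<close> of \<open>Q\<close> holds the coefficients
  of a polynomial \<open>p\<close> of unit norm, the diagonal entry of \<open>M\<close> is the
  integral of \<open>p\<close> squared against the weight \<mu>, and this weight lies between -1 and
  1 on the interval.\<close>

lemma abs_eigenvalue_angular_matrix_le_1:
  assumes eig: "is_eigen_decomposition n (angular_matrix n) Q M" and k: "k < n"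
  shows "\<bar>M $$ (k,k)\<bar> \<le> 1"
proof -
  let ?A = "angular_matrix n"
  have c: "?A \<in> carrier_mat n n" by (simp add: angular_matrix_def)
  have Q: "Q \<in> carrier_mat n n" "M \<in> carrier_mat n n" "Q\<^sup>T * Q = 1\<^sub>m n" "?A = Q * M * Q\<^sup>T"
    using eig by (auto simp: is_eigen_decomposition_def orthonormal_cols_def)
  have "Q\<^sup>T * ?A * Q = M"
    unfolding Q(4) using Q(1,2,3) by (simp add: mult_mat_assoc mult_mat_cancel_left)
  then have M: "M $$ (k,k) = (\<Sum>i<n. \<Sum>l<n. Q $$ (i,k) * ?A $$ (i,l) * Q $$ (l,k))"
    using quadratic_form_index[OF c Q(1) k] by simp
  define p where "p = (\<Sum>i<n. Polynomial.smult (Q $$ (i,k)) (normalized_legendre i))"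
  have "M $$ (k,k) = poly_integral ([:0, 1:] * p * p)"
    unfolding p_def poly_integral_quadratic_form M by (simp add: angular_matrix_eq)
  \<comment> \<open>\<open>p\<close> has unit norm because both the Legendre polynomials and the
    columns of \<open>Q\<close> are orthonormal.\<close>
  moreover have "poly_integral (1 * p * p) = 1"
  proof -
    have "poly_integral (1 * normalized_legendre i * normalized_legendre l) = 1\<^sub>m n $$ (i,l)"
      if "i < n" "l < n" for i l
    proof -
      have "poly (1 * normalized_legendre i * normalized_legendre l) =
          (\<lambda>\<mu>. poly (normalized_legendre i) \<mu> * poly (normalized_legendre l) \<mu>)"
        by (simp add: fun_eq_iff)
      then show ?thesis
        using that normalized_legendre_orthonormal[of i l] by (simp only: poly_integral_def index_one_mat)
    qed
    then have "poly_integral (1 * p * p) =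
        (\<Sum>i<n. \<Sum>l<n. Q $$ (i,k) * 1\<^sub>m n $$ (i,l) * Q $$ (l,k))"
      unfolding p_def poly_integral_quadratic_form by (intro sum.cong refl) (simp only: lessThan_iff)
    also have "\<dots> = (Q\<^sup>T * 1\<^sub>m n * Q) $$ (k,k)"
      using quadratic_form_index[OF one_carrier_mat Q(1) k] by simp
    also have "\<dots> = 1" using Q k by simp
    finally show ?thesis .
  qed
  moreover have "poly_integral ([:0, 1:] * p * p) \<le> poly_integral (1 * p * p)"
  proof (rule poly_integral_mono)
    fix x :: real assume "x \<in> {-1..1}"
    then have "x * (poly p x)\<^sup>2 \<le> 1 * (poly p x)\<^sup>2" by (intro mult_right_mono) auto
    then show "poly ([:0, 1:] * p * p) x \<le> poly (1 * p * p) x"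
      by (simp add: power2_eq_square mult.assoc)
  qed
  moreover have "poly_integral (Polynomial.smult (-1) (1 * p * p)) \<le> poly_integral ([:0, 1:] * p * p)"
  proof (rule poly_integral_mono)
    fix x :: real assume "x \<in> {-1..1}"
    then have "-1 * (poly p x)\<^sup>2 \<le> x * (poly p x)\<^sup>2" by (intro mult_right_mono) auto
    then show "poly (Polynomial.smult (-1) (1 * p * p)) x \<le> poly ([:0, 1:] * p * p) x"
      by (simp add: power2_eq_square mult.assoc)
  qed
  ultimately show ?thesis by (simp only: poly_integral_smult)
qed

section \<open>Upwind transport\<close>

definition cyc_succ :: "nat \<Rightarrow> nat \<Rightarrow> nat" where "cyc_succ N j = (j + 1) mod N"
text \<open>The case \<open>j = 0\<close> is separate because subtraction on natural numbers stops
  at 0 and does not wrap around.\<close>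

definition cyc_pred :: "nat \<Rightarrow> nat \<Rightarrow> nat" where "cyc_pred N j = (if j = 0 then N - 1 else j - 1)"

lemma cyc_less [simp]: "j < N \<Longrightarrow> cyc_succ N j < N" "j < N \<Longrightarrow> cyc_pred N j < N"
  by (auto simp: cyc_succ_def cyc_pred_def)

lemma cyc_succ_eq: "j < N \<Longrightarrow> cyc_succ N j = (if j = N - 1 then 0 else j + 1)"
  by (auto simp: cyc_succ_def)

lemma cyc_inverse [simp]:
  "j < N \<Longrightarrow> cyc_succ N (cyc_pred N j) = j" "j < N \<Longrightarrow> cyc_pred N (cyc_succ N j) = j"
  by (auto simp: cyc_succ_eq cyc_pred_def)

lemma cyc_succ_eq_iff: "i < N \<Longrightarrow> j < N \<Longrightarrow> j = cyc_succ N i \<longleftrightarrow> i = cyc_pred N j"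
  by auto

lemma sum_cyc_succ: "(\<Sum>j<N. f (cyc_succ N j)) = (\<Sum>j<N. f j)"
  by (rule sum.reindex_bij_witness[of _ "cyc_pred N" "cyc_succ N"]) auto

lemma sum_cyc_pred: "(\<Sum>j<N. f (cyc_pred N j)) = (\<Sum>j<N. f j)"
  by (rule sum.reindex_bij_witness[of _ "cyc_succ N" "cyc_pred N"]) auto

text \<open>The matrices describe the lower neighbour of a row as the column whose successor is that
  row. Solving for the column by \<open>cyc_pred\<close> makes each row readable as a finite
  difference.\<close>

lemma stencil_index:
  assumes "i < N" "j < N"
  shows "Dx_mat N dx $$ (j,i) =
      (if i = cyc_succ N j then 1 / (2 * dx) else if i = cyc_pred N j then - 1 / (2 * dx) else 0)"
    and "Dxx_mat N dx $$ (j,i) =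
      (if i = j then - 1 / dx else if i = cyc_succ N j \<or> i = cyc_pred N j then 1 / (2 * dx) else 0)"
  unfolding cyc_succ_eq_iff[OF assms, symmetric] cyc_succ_def
  using assms by (simp_all only: Dx_mat_def Dxx_mat_def index_mat prod.case)

lemma Dx_mult_index:
  assumes N: "3 \<le> N" and U: "U \<in> carrier_mat N p" and j: "j < N" "k < p"
  shows "(Dx_mat N dx * U) $$ (j,k) = (U $$ (cyc_succ N j, k) - U $$ (cyc_pred N j, k)) / (2 * dx)"
proof -
  \<comment> \<open>This is where \<open>3 \<le> N\<close> enters: with two cells both neighbours
    coincide, and the nested conditions do not split into a sum of single entries.\<close>
  have ne: "cyc_succ N j \<noteq> cyc_pred N j" using N j by (auto simp: cyc_succ_eq cyc_pred_def)
  have "(Dx_mat N dx * U) $$ (j,k) = (\<Sum>i<N. Dx_mat N dx $$ (j,i) * U $$ (i,k))"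
    using U j by (simp add: scalar_prod_def atLeast0LessThan Dx_mat_def)
  also have "\<dots> = (\<Sum>i<N. (if i = cyc_succ N j then 1 / (2 * dx) * U $$ (i,k) else 0)
      + (if i = cyc_pred N j then - 1 / (2 * dx) * U $$ (i,k) else 0))"
    using ne j by (intro sum.cong refl) (simp add: stencil_index)
  also have "\<dots> = (U $$ (cyc_succ N j, k) - U $$ (cyc_pred N j, k)) / (2 * dx)"
    using j by (simp add: sum.distrib sum.delta diff_divide_distrib)
  finally show ?thesis .
qed

lemma Dxx_mult_index:
  assumes N: "3 \<le> N" and U: "U \<in> carrier_mat N p" and j: "j < N" "k < p"
  shows "(Dxx_mat N dx * U) $$ (j,k) =
    (U $$ (cyc_succ N j, k) - 2 * U $$ (j,k) + U $$ (cyc_pred N j, k)) / (2 * dx)"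
proof -
  have ne: "cyc_succ N j \<noteq> cyc_pred N j" "cyc_succ N j \<noteq> j" "cyc_pred N j \<noteq> j"
    using N j by (auto simp: cyc_succ_eq cyc_pred_def)
  have "(Dxx_mat N dx * U) $$ (j,k) = (\<Sum>i<N. Dxx_mat N dx $$ (j,i) * U $$ (i,k))"
    using U j by (simp add: scalar_prod_def atLeast0LessThan Dxx_mat_def)
  also have "\<dots> = (\<Sum>i<N. (if i = cyc_succ N j then 1 / (2 * dx) * U $$ (i,k) else 0)
      + (if i = cyc_pred N j then 1 / (2 * dx) * U $$ (i,k) else 0)
      + (if i = j then - 1 / dx * U $$ (i,k) else 0))"
    using ne j by (intro sum.cong refl) (auto simp: stencil_index)
  also have "\<dots> = (U $$ (cyc_succ N j, k) - 2 * U $$ (j,k) + U $$ (cyc_pred N j, k)) / (2 * dx)"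
    using j by (simp add: sum.distrib sum.delta diff_divide_distrib add_divide_distrib)
  finally show ?thesis .
qed

section \<open>Contraction property of the upwind step\<close>

lemma square_convex_combination_le:
  fixes a x y :: real
  assumes "0 \<le> a" "a \<le> 1"
  shows "((1 - a) * x + a * y)\<^sup>2 \<le> (1 - a) * x\<^sup>2 + a * y\<^sup>2"
proof -
  have "(1 - a) * x\<^sup>2 + a * y\<^sup>2 - ((1 - a) * x + a * y)\<^sup>2 = (1 - a) * a * (x - y)\<^sup>2"
    by (simp add: power2_eq_square algebra_simps)
  moreover have "0 \<le> (1 - a) * a * (x - y)\<^sup>2" using assms by simp
  ultimately show ?thesis by linarith
qed

text \<open>Here \<open>c\<close> is the ratio \<open>dt / dx\<close> and \<open>l\<close> an
  eigenvalue. The viscosity cancels the downwind half of the central difference, which leaves a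
  convex combination of \<open>g j\<close> and its upwind neighbour with weight
  \<open>c * \<bar>l\<bar>\<close>. Convexity of the square and periodicity give the bound.\<close>

lemma sum_square_upwind_le:
  fixes g :: "nat \<Rightarrow> real"
  assumes c: "0 \<le> c" "c \<le> 1" and l: "\<bar>l\<bar> \<le> 1"
  shows "(\<Sum>j<N. (g j - c * l * (g (cyc_succ N j) - g (cyc_pred N j)) / 2
      + c * \<bar>l\<bar> * (g (cyc_succ N j) - 2 * g j + g (cyc_pred N j)) / 2)\<^sup>2) \<le> (\<Sum>j<N. (g j)\<^sup>2)"
proof -
  define a where "a = c * \<bar>l\<bar>"
  have a: "0 \<le> a" "a \<le> 1" using c l by (auto simp: a_def mult_le_one)
  \<comment> \<open>One estimate for both wind directions: \<open>s\<close> is the predecessor if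
    \<open>0 \<le> l\<close> and the successor otherwise. The premise is the invariance of periodic
    sums under the shift.\<close>
  have key: "(\<Sum>j<N. ((1 - a) * g j + a * g (s j))\<^sup>2) \<le> (\<Sum>j<N. (g j)\<^sup>2)"
    if "(\<Sum>j<N. (g (s j))\<^sup>2) = (\<Sum>j<N. (g j)\<^sup>2)" for s
  proof -
    have "(\<Sum>j<N. ((1 - a) * g j + a * g (s j))\<^sup>2) \<le> (\<Sum>j<N. (1 - a) * (g j)\<^sup>2 + a * (g (s j))\<^sup>2)"
      by (intro sum_mono square_convex_combination_le a)
    also have "\<dots> = (\<Sum>j<N. (g j)\<^sup>2)"
      by (simp add: sum.distrib that flip: sum_distrib_left) (simp add: algebra_simps)
    finally show ?thesis .
  qed
  show ?thesis
  proof (cases "0 \<le> l")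
    case True
    then have "g j - c * l * (g (cyc_succ N j) - g (cyc_pred N j)) / 2
        + c * \<bar>l\<bar> * (g (cyc_succ N j) - 2 * g j + g (cyc_pred N j)) / 2
        = (1 - a) * g j + a * g (cyc_pred N j)" for j
      by (simp add: a_def field_simps)
    then show ?thesis
      using key[OF sum_cyc_pred[of "\<lambda>j. (g j)\<^sup>2" N]] by simp
  next
    case False
    then have "g j - c * l * (g (cyc_succ N j) - g (cyc_pred N j)) / 2
        + c * \<bar>l\<bar> * (g (cyc_succ N j) - 2 * g j + g (cyc_pred N j)) / 2
        = (1 - a) * g j + a * g (cyc_succ N j)" for j
      by (simp add: a_def field_simps)
    then show ?thesis
      using key[OF sum_cyc_succ[of "\<lambda>j. (g j)\<^sup>2" N]] by simp
  qed
qed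

lemma mult_diagonal_mat_index:
  assumes "D \<in> carrier_mat n n" "diagonal_mat D" "dim_col A = n" "i < dim_row A" "j < n"
  shows "(A * D) $$ (i,j) = A $$ (i,j) * D $$ (j,j)"
proof -
  have "A * D = Matrix.mat (dim_row A) n (\<lambda>(i,j). A $$ (i,j) * D $$ (j,j))"
    using assms by (subst diagonal_mat_eq_mat_diag[of D n])
      (auto intro!: mat_diag_mult_right)
  then show ?thesis using assms by simp
qed

lemma sqnorm_swap: "sqnorm M = (\<Sum>k<dim_col M. \<Sum>j<dim_row M. (M $$ (j,k))\<^sup>2)"
  unfolding sqnorm_def by (rule sum.swap)

text \<open>The stencils act from the left and the angular matrices from the right. Passing to
  \<open>W = U * Q\<close> therefore commutes with the former, diagonalizes \<open>A\<close> and
  \<open>absA\<close> together, and preserves the norm.\<close>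

lemma sqnorm_upwind_le:
  assumes N: "3 \<le> N" and dx: "0 < dx" and dt: "0 < dt" "dt \<le> dx"
    and eig: "is_eigen_decomposition n A Q M" and M1: "\<And>k. k < n \<Longrightarrow> \<bar>M $$ (k,k)\<bar> \<le> 1"
    and absA: "absA = Q * map_mat abs M * Q\<^sup>T" and U: "U \<in> carrier_mat N n"
  shows "sqnorm (U - dt \<cdot>\<^sub>m (Dx_mat N dx * U * A) + dt \<cdot>\<^sub>m (Dxx_mat N dx * U * absA)) \<le> sqnorm U"
    (is "sqnorm ?Y \<le> _")
proof -
  have Q: "Q \<in> carrier_mat n n" "orthonormal_cols Q" and M: "M \<in> carrier_mat n n" "diagonal_mat M"
    and A: "A = Q * M * Q\<^sup>T"
    using eig by (auto simp: is_eigen_decomposition_def)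
  have M': "map_mat abs M \<in> carrier_mat n n" "diagonal_mat (map_mat abs M)"
    using M by (auto simp: diagonal_mat_def)
  have Ac: "A \<in> carrier_mat n n" "absA \<in> carrier_mat n n"
    using Q M by (auto simp: A absA)
  have D: "Dx_mat N dx \<in> carrier_mat N N" "Dxx_mat N dx \<in> carrier_mat N N"
    by (auto simp: Dx_mat_def Dxx_mat_def)
  define W where "W = U * Q"
  have W: "W \<in> carrier_mat N n" using U Q by (simp add: W_def)
  have QA: "A * Q = Q * M" "absA * Q = Q * map_mat abs M"
    using Q M by (simp_all add: A absA mult_mat_assoc orthonormal_cols_def)
  have "?Y * Q = W - dt \<cdot>\<^sub>m (Dx_mat N dx * W * M) + dt \<cdot>\<^sub>m (Dxx_mat N dx * W * map_mat abs M)"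
    using U Q Ac D M QA by (simp add: mult_mat_distrib mult_smult_mat mult_mat_assoc W_def)
  then have Y: "(?Y * Q) $$ (j,k) = W $$ (j,k)
      - dt / dx * M $$ (k,k) * (W $$ (cyc_succ N j, k) - W $$ (cyc_pred N j, k)) / 2
      + dt / dx * \<bar>M $$ (k,k)\<bar> * (W $$ (cyc_succ N j, k) - 2 * W $$ (j,k) + W $$ (cyc_pred N j, k)) / 2"
    if "j < N" "k < n" for j k
    using that W D M M' Dx_mult_index[OF N W that] Dxx_mult_index[OF N W that] dx
    by (simp add: mult_diagonal_mat_index[of _ n] mult_ac del: index_mult_mat(1) assoc_mult_mat)
  \<comment> \<open>Since \<open>Q\<close> is square, its rows are orthonormal too, so
    \<open>sqnorm_mult_transpose\<close> also covers multiplication by \<open>Q\<close>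
    itself.\<close>
  have orth: "orthonormal_cols (Q\<^sup>T)"
    using Q by (rule orthonormal_cols_square_transpose)
  have "sqnorm ?Y = sqnorm (?Y * Q)"
    using sqnorm_mult_transpose[OF orth, of ?Y] Q Ac U D by simp
  \<comment> \<open>The sum over columns goes outside: column \<open>k\<close> is a scalar transport
    problem with speed \<open>M $$ (k,k)\<close>.\<close>
  also have "\<dots> = (\<Sum>k<n. \<Sum>j<N. ((?Y * Q) $$ (j,k))\<^sup>2)"
    using U Q Ac D unfolding sqnorm_swap by simp
  also have "\<dots> \<le> (\<Sum>k<n. \<Sum>j<N. (W $$ (j,k))\<^sup>2)"
  proof (rule sum_mono)
    fix k assume "k \<in> {..<n}"
    then have k: "k < n" by simp
    have "(\<Sum>j<N. ((?Y * Q) $$ (j,k))\<^sup>2) = (\<Sum>j<N. (W $$ (j,k)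
      - dt / dx * M $$ (k,k) * (W $$ (cyc_succ N j, k) - W $$ (cyc_pred N j, k)) / 2
      + dt / dx * \<bar>M $$ (k,k)\<bar> * (W $$ (cyc_succ N j, k) - 2 * W $$ (j,k) + W $$ (cyc_pred N j, k)) / 2)\<^sup>2)"
      using k by (intro sum.cong refl) (simp only: Y lessThan_iff)
    also have "\<dots> \<le> (\<Sum>j<N. (W $$ (j,k))\<^sup>2)"
      using dt dx M1[OF k] by (intro sum_square_upwind_le) auto
    finally show "(\<Sum>j<N. ((?Y * Q) $$ (j,k))\<^sup>2) \<le> (\<Sum>j<N. (W $$ (j,k))\<^sup>2)" .
  qed
  also have "\<dots> = sqnorm W"
    using W unfolding sqnorm_swap by simp
  also have "\<dots> = sqnorm U"
    using sqnorm_mult_transpose[OF orth, of U] Q U by (simp add: W_def)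
  finally show ?thesis .
qed

section \<open>Truncation\<close>

lemma col_mat_smult: "col_mat v * Matrix.mat 1 1 (\<lambda>_. c) = col_mat (c \<cdot>\<^sub>v v)"
  by (intro eq_matI) (auto simp: scalar_prod_def)

lemma euclid_norm_eq_0_iff: "euclid_norm v = 0 \<longleftrightarrow> v = 0\<^sub>v (dim_vec v)"
proof -
  have "v \<bullet> v = (\<Sum>i<dim_vec v. (v $ i)\<^sup>2)"
    by (simp add: scalar_prod_def power2_eq_square atLeast0LessThan)
  then have "euclid_norm v = 0 \<longleftrightarrow> (\<forall>i<dim_vec v. v $ i = 0)"
    by (auto simp: euclid_norm_def sum_nonneg_eq_0_iff)
  then show ?thesis by (auto simp: Matrix.vec_eq_iff)
qed

text \<open>Truncation multiplies the unfactored matrix on the right by an orthogonal projection, so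
  it commutes with the row weights of the energy.\<close>

lemma standard_truncation_projection:
  assumes tr: "standard_truncation \<theta> Xa Sa Va X1 S1 V1"
    and X: "Xa \<in> carrier_mat m n" and S: "Sa \<in> carrier_mat n n" and V: "Va \<in> carrier_mat p n"
  shows "\<exists>J. dim_row J = n \<and> orthonormal_cols J \<and> X1 * S1 * V1\<^sup>T = Xa * Sa * J * (Va * J)\<^sup>T"
proof -
  from tr S obtain P \<Sigma> Q r1 where svd: "is_svd n Sa P \<Sigma> Q" and r1: "r1 \<le> n"
    and eqs: "S1 = mat_diag r1 (\<lambda>j. \<Sigma> $$ (j,j))" "X1 = Xa * take_cols r1 P" "V1 = Va * take_cols r1 Q"
    unfolding standard_truncation_def by auto
  have c: "P \<in> carrier_mat n n" "Q \<in> carrier_mat n n" "orthonormal_cols Q"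
    using svd by (auto simp: is_svd_def)
  have "X1 * S1 * V1\<^sup>T = Xa * (take_cols r1 P * mat_diag r1 (\<lambda>j. \<Sigma> $$ (j,j))) * (Va * take_cols r1 Q)\<^sup>T"
    using c X r1 unfolding eqs by (subst mult_mat_assoc[of Xa]) (auto simp: mat_diag_def)
  \<comment> \<open>The retained left factor equals \<open>Sa\<close> applied to the retained right
    singular vectors, which supplies the witness \<open>take_cols r1 Q\<close>.\<close>
  also have "\<dots> = Xa * Sa * take_cols r1 Q * (Va * take_cols r1 Q)\<^sup>T"
    using c X S r1 unfolding svd_mult_take_cols[OF svd r1, symmetric] by (subst (2) mult_mat_assoc) auto
  finally show ?thesis
    using c r1 by (intro exI[of _ "take_cols r1 Q"]) (auto intro: orthonormal_take_cols)
qed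

text \<open>Only the columns after the first are truncated, so \<open>J\<close> is block diagonal
  with a 1 for the zeroth moment and the retained right singular vectors for the rest. Hypothesis
  \<open>e1\<close> matches the unit vector kept by the truncation with the first column of
  \<open>Va\<close>. The final QR factors \<open>R1\<close> and \<open>R2\<close> merely regroup the
  product.\<close>

lemma conservative_truncation_projection:
  assumes tr: "conservative_truncation \<theta> Xa Sa Va X1 S1 V1"
    and X: "Xa \<in> carrier_mat m n" and S: "Sa \<in> carrier_mat n n" and V: "Va \<in> carrier_mat p n"
    and n: "0 < n" and e1: "col Va 0 = unit_vec p 0"
  shows "\<exists>J. dim_row J = n \<and> orthonormal_cols J \<and> X1 * S1 * V1\<^sup>T = Xa * Sa * J * (Va * J)\<^sup>T"
proof -
  define Ka where "Ka = Xa * Sa"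
  have Ka: "Ka \<in> carrier_mat m n" using X S by (simp add: Ka_def)
  define k where "k = n - 1"
  have dims: "dim_row Ka = m" "dim_row Va = p" "dim_col (drop_cols 1 Ka) = k"
    using Ka V by (auto simp: k_def)
  from tr obtain Xc Xr Sr P \<Sigma> Q r1 R1 R2 where
    Xc: "Xc \<in> carrier_vec m" "col Ka 0 \<noteq> 0\<^sub>v m \<longrightarrow> Xc = (1 / euclid_norm (col Ka 0)) \<cdot>\<^sub>v col Ka 0"
    and qr: "is_qr_decomposition (drop_cols 1 Ka) Xr Sr"
    and svd: "is_svd k Sr P \<Sigma> Q" and r1: "r1 \<le> k"
    and qr1: "is_qr_decomposition (col_mat Xc @\<^sub>c (Xr * take_cols r1 P)) X1 R1"
    and qr2: "is_qr_decomposition (col_mat (unit_vec p 0) @\<^sub>c (drop_cols 1 Va * take_cols r1 Q)) V1 R2"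
    and S1: "S1 = R1 * four_block_mat (Matrix.mat 1 1 (\<lambda>_. euclid_norm (col Ka 0))) (0\<^sub>m 1 r1)
       (0\<^sub>m r1 1) (mat_diag r1 (\<lambda>j. \<Sigma> $$ (j,j))) * R2\<^sup>T"
    unfolding conservative_truncation_def Let_def Ka_def[symmetric] dims by (elim exE conjE) (rule that)
  define E where "E = mat_diag r1 (\<lambda>j. \<Sigma> $$ (j,j))"
  define D where "D = four_block_mat (Matrix.mat 1 1 (\<lambda>_. euclid_norm (col Ka 0))) (0\<^sub>m 1 r1) (0\<^sub>m r1 1) E"
  define Qr where "Qr = take_cols r1 Q"
  define J where "J = four_block_mat (1\<^sub>m 1) (0\<^sub>m 1 r1) (0\<^sub>m k 1) Qr"
  have c: "P \<in> carrier_mat k k" "Q \<in> carrier_mat k k" "orthonormal_cols Q"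
    using svd by (auto simp: is_svd_def)
  have Qr: "Qr \<in> carrier_mat k r1" "orthonormal_cols Qr"
    using c r1 orthonormal_take_cols[of Q r1] by (auto simp: Qr_def)
  have E: "E \<in> carrier_mat r1 r1" by (simp add: E_def)
  have XS: "Xr \<in> carrier_mat m k" "Sr \<in> carrier_mat k k" "drop_cols 1 Ka = Xr * Sr"
    using qr Ka unfolding is_qr_decomposition_def by (auto simp: k_def)
  have XR: "X1 \<in> carrier_mat m (1 + r1)" "R1 \<in> carrier_mat (1 + r1) (1 + r1)"
    "col_mat Xc @\<^sub>c (Xr * take_cols r1 P) = X1 * R1"
    using qr1 Xc c r1 unfolding is_qr_decomposition_def by auto
  have VR: "V1 \<in> carrier_mat p (1 + r1)" "R2 \<in> carrier_mat (1 + r1) (1 + r1)"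
    "col_mat (unit_vec p 0) @\<^sub>c (drop_cols 1 Va * Qr) = V1 * R2"
    using qr2 Qr unfolding is_qr_decomposition_def Qr_def by auto
  have D: "D \<in> carrier_mat (1 + r1) (1 + r1)" using E by (intro carrier_matI) (auto simp: D_def)
  have J: "dim_row J = n" "dim_col J = 1 + r1" "orthonormal_cols J"
    using Qr n orthonormal_block[of Qr] by (auto simp: J_def k_def)
  have block_J: "A * J = col_mat (col A 0) @\<^sub>c (drop_cols 1 A * Qr)" if "dim_col A = n" for A
  proof -
    have "A * J = (col_mat (col A 0) @\<^sub>c drop_cols 1 A) * J"
      using append_cols_split_first[of A] that n by simp
    also have "\<dots> = (col_mat (col A 0) * 1\<^sub>m 1) @\<^sub>c (drop_cols 1 A * Qr)"
      using append_cols_mult_block[of "col_mat (col A 0)" "drop_cols 1 A" "1\<^sub>m 1" Qr] that Qr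
      by (simp add: J_def k_def)
    finally show ?thesis by simp
  qed
  \<comment> \<open>If the first column vanishes, \<open>Xc\<close> is an arbitrary unit vector, but
    its coefficient is then 0.\<close>
  have "euclid_norm (col Ka 0) \<cdot>\<^sub>v Xc = col Ka 0"
  proof (cases "col Ka 0 = 0\<^sub>v m")
    case True
    then show ?thesis using Xc(1) Ka euclid_norm_eq_0_iff[of "col Ka 0"] by (auto simp del: col_dim)
  next
    case False
    then have "euclid_norm (col Ka 0) \<noteq> 0" using Ka euclid_norm_eq_0_iff[of "col Ka 0"] by simp
    then show ?thesis unfolding Xc(2)[rule_format, OF False] by (auto simp: smult_smult_assoc)
  qed
  then have "(X1 * R1) * D = col_mat (col Ka 0) @\<^sub>c (Xr * take_cols r1 P * E)"
    using append_cols_mult_block[of "col_mat Xc" "Xr * take_cols r1 P" "Matrix.mat 1 1 (\<lambda>_. euclid_norm (col Ka 0))" E]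
      Xc XS c r1 E
    by (simp add: D_def col_mat_smult[unfolded One_nat_def] flip: XR(3))
  also have "Xr * take_cols r1 P * E = Xr * (take_cols r1 P * E)"
    using XS c r1 E by (intro mult_mat_assoc) auto
  also have "\<dots> = drop_cols 1 Ka * Qr"
    using XS c r1 Qr unfolding E_def svd_mult_take_cols[OF svd r1, symmetric]
    by (simp add: mult_mat_assoc XS(3) flip: Qr_def)
  also have "col_mat (col Ka 0) @\<^sub>c (drop_cols 1 Ka * Qr) = Ka * J"
    using Ka by (simp add: block_J)
  finally have *: "X1 * R1 * D = Ka * J" .
  have "V1 * R2 = Va * J"
    using V e1 VR(3) by (simp add: block_J)
  moreover have "X1 * S1 * V1\<^sup>T = (X1 * R1 * D) * (V1 * R2)\<^sup>T"
    unfolding S1 D_def[symmetric, unfolded E_def] using XR(1,2) VR(1,2) D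
    by (simp add: mult_mat_assoc transpose_mult_mat)
  ultimately show ?thesis using J by (auto simp: * Ka_def)
qed

lemma energy_eq_sqnorm:
  assumes "B \<in> carrier_vec n" "dim_row v = n"
  shows "energy B v = (sqnorm (mat_diag n (\<lambda>j. B $ j) * v) + (\<Sum>j<n. (B $ j)\<^sup>2)) / 2"
  using assms by (subst mat_diag_mult_left[of v n "dim_col v"]) (auto simp: energy_def sqnorm_def)

text \<open>The weights \<open>D\<close> act from the left and \<open>J\<close> from the right. Both
  \<open>V\<close> and \<open>V * J\<close> have orthonormal columns and drop out of the norm,
  multiplication by \<open>J\<close> can only decrease it, and the second part of the energy depends
  on \<open>B\<close> alone.\<close>

lemma energy_projection_le:
  assumes "B \<in> carrier_vec n" "K \<in> carrier_mat n m" "V \<in> carrier_mat p m"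
    and V: "orthonormal_cols V" and J: "dim_row J = m" "orthonormal_cols J"
  shows "energy B (K * J * (V * J)\<^sup>T) \<le> energy B (K * V\<^sup>T)"
proof -
  define D where "D = mat_diag n (\<lambda>j. B $ j)"
  have D: "D \<in> carrier_mat n n" by (simp add: D_def)
  have VJ: "orthonormal_cols (V * J)"
    using V J assms(3)
    by (simp add: orthonormal_cols_def transpose_mult_mat mult_mat_assoc mult_mat_cancel_left)
  have "sqnorm (D * (K * J * (V * J)\<^sup>T)) = sqnorm (D * K * J * (V * J)\<^sup>T)"
    using assms D by (simp add: mult_mat_assoc transpose_mult_mat)
  also have "\<dots> = sqnorm (D * K * J)"
    using assms D by (intro sqnorm_mult_transpose[OF VJ]) simp
  also have "\<dots> \<le> sqnorm (D * K)"
    using assms D by (intro sqnorm_mult_le) auto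
  also have "\<dots> = sqnorm (D * K * V\<^sup>T)"
    using assms D by (intro sqnorm_mult_transpose[symmetric]) auto
  also have "\<dots> = sqnorm (D * (K * V\<^sup>T))"
    using assms D by (simp add: mult_mat_assoc)
  finally show ?thesis
    using assms by (simp add: energy_eq_sqnorm[of B n] D_def)
qed

lemma truncation_energy_le:
  assumes "standard_truncation \<theta> Xa Sa Va X1 S1 V1 \<or> conservative_truncation \<theta> Xa Sa Va X1 S1 V1"
    and "Xa \<in> carrier_mat n m" "Sa \<in> carrier_mat m m" "Va \<in> carrier_mat p m"
    and "0 < m" "col Va 0 = unit_vec p 0" "orthonormal_cols Va" "B \<in> carrier_vec n"
  shows "energy B (X1 * S1 * V1\<^sup>T) \<le> energy B (Xa * Sa * Va\<^sup>T)"
proof -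
  obtain J where J: "dim_row J = m" "orthonormal_cols J" "X1 * S1 * V1\<^sup>T = Xa * Sa * J * (Va * J)\<^sup>T"
    using assms standard_truncation_projection[of \<theta> Xa Sa Va X1 S1 V1 n m p]
      conservative_truncation_projection[of \<theta> Xa Sa Va X1 S1 V1 n m p] by blast
  show ?thesis
    unfolding J(3) using assms J by (intro energy_projection_le[of B n _ m _ p]) auto
qed

section \<open>Energy stability\<close>

lemma conj_diag_carrier:
  "B \<in> carrier_vec n \<Longrightarrow> D \<in> carrier_mat n n \<Longrightarrow> conj_diag B D \<in> carrier_mat n n"
  by (auto simp: conj_diag_def mat_diag_def)

text \<open>The outer inverse cancels as \<open>B\<close> has no zero entry. In the weighted
  variable \<open>diag(B) v\<close> the conjugated stencils thus become the plain ones, to which the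
  upwind estimate applies.\<close>

lemma mat_diag_mult_conj_diag:
  fixes B :: "real vec"
  assumes B: "B \<in> carrier_vec n" "\<forall>j<n. B $ j \<noteq> 0" and D: "D \<in> carrier_mat n n"
  shows "mat_diag n (\<lambda>j. B $ j) * conj_diag B D = D * mat_diag n (\<lambda>j. B $ j)"
proof -
  have "mat_diag n (\<lambda>j. B $ j) * mat_diag n (\<lambda>j. 1 / B $ j) = 1\<^sub>m n"
    unfolding mat_diag_diag using B by (intro eq_matI) (auto simp: mat_diag_def)
  then show ?thesis
    using B D by (simp add: conj_diag_def mult_mat_assoc mult_mat_cancel_left mat_diag_def)
qed

text \<open>The two projections touch only the outer factors, so it suffices that the bases
  reproduce \<open>Y\<close> and \<open>Z\<close>, whatever the core \<open>S\<close> is.\<close>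

lemma two_sided_projection:
  fixes X V Y Z S :: "real mat"
  assumes "X * (X\<^sup>T * Y) = Y" "V * (V\<^sup>T * Z) = Z"
    and "dim_row Y = dim_row X" "dim_row Z = dim_row V" "dim_row S = dim_col Y" "dim_col S = dim_col Z"
  shows "X * (X\<^sup>T * (Y * S * Z\<^sup>T) * V) * V\<^sup>T = Y * S * Z\<^sup>T"
proof -
  have "X * (X\<^sup>T * (Y * S * Z\<^sup>T) * V) * V\<^sup>T = (X * (X\<^sup>T * Y)) * S * (V * (V\<^sup>T * Z))\<^sup>T"
    using assms(3-) by (simp add: mult_mat_assoc transpose_mult_mat)
  then show ?thesis by (simp only: assms(1,2))
qed

text \<open>The bases are augmented so that the Galerkin projection of the S-step loses nothing.\<close>

lemma S_step_exact:
  fixes Gx Gxx A absA X0 S0 V0 Xs Vs :: "real mat"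
  assumes "X0 \<in> carrier_mat n r" "S0 \<in> carrier_mat r r" "V0 \<in> carrier_mat p r"
    and "Gx \<in> carrier_mat n n" "Gxx \<in> carrier_mat n n" "A \<in> carrier_mat p p" "absA \<in> carrier_mat p p"
    and "dim_row Xs = n" "dim_row Vs = p"
    and X: "Xs * (Xs\<^sup>T * X0) = X0" "Xs * (Xs\<^sup>T * (Gx * X0)) = Gx * X0" "Xs * (Xs\<^sup>T * (Gxx * X0)) = Gxx * X0"
    and V: "Vs * (Vs\<^sup>T * V0) = V0" "Vs * (Vs\<^sup>T * (A\<^sup>T * V0)) = A\<^sup>T * V0"
      "Vs * (Vs\<^sup>T * (absA\<^sup>T * V0)) = absA\<^sup>T * V0"
  defines "St \<equiv> projected_S0 X0 S0 V0 Xs Vs" and "v0 \<equiv> X0 * S0 * V0\<^sup>T"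
  shows "Xs * St * Vs\<^sup>T = v0"
    and "Xs * S_step dt \<sigma> Gx Gxx A absA Xs Vs St * Vs\<^sup>T =
      (1 / (1 + \<sigma> * dt)) \<cdot>\<^sub>m (v0 - dt \<cdot>\<^sub>m (Gx * v0 * A) + dt \<cdot>\<^sub>m (Gxx * v0 * absA))"
proof -
  note dims = assms(1-9)
  have St: "St = Xs\<^sup>T * v0 * Vs" "dim_row St = dim_col Xs" "dim_col St = dim_col Vs"
    using dims by (simp_all add: St_def v0_def projected_S0_def transpose_mult_mat mult_mat_assoc)
  show 1: "Xs * St * Vs\<^sup>T = v0"
    unfolding St v0_def using dims X V by (intro two_sided_projection) auto
  \<comment> \<open>A flux term factors as \<open>(G * X0) * S0 * (C\<^sup>T * V0)\<^sup>T\<close>;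
    this explains why the bases are enlarged by \<open>G * X0\<close> and
    \<open>C\<^sup>T * V0\<close>.\<close>
  have flux: "Xs * (Xs\<^sup>T * G * Xs * St * Vs\<^sup>T * C * Vs) * Vs\<^sup>T = G * v0 * C"
    if GC: "G \<in> carrier_mat n n" "C \<in> carrier_mat p p"
      and "Xs * (Xs\<^sup>T * (G * X0)) = G * X0" "Vs * (Vs\<^sup>T * (C\<^sup>T * V0)) = C\<^sup>T * V0" for G C
  proof -
    have "Xs\<^sup>T * G * Xs * St * Vs\<^sup>T * C * Vs = Xs\<^sup>T * (G * (Xs * St * Vs\<^sup>T) * C) * Vs"
      using dims St GC by (simp add: mult_mat_assoc)
    also have "G * (Xs * St * Vs\<^sup>T) * C = (G * X0) * S0 * (C\<^sup>T * V0)\<^sup>T"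
      unfolding 1 v0_def using dims GC by (simp add: mult_mat_assoc transpose_mult_mat)
    finally have "Xs * (Xs\<^sup>T * G * Xs * St * Vs\<^sup>T * C * Vs) * Vs\<^sup>T = (G * X0) * S0 * (C\<^sup>T * V0)\<^sup>T"
      using dims that by (simp only:) (intro two_sided_projection, auto)
    also have "\<dots> = G * v0 * C"
      unfolding v0_def using dims GC by (simp add: mult_mat_assoc transpose_mult_mat)
    finally show ?thesis .
  qed
  define P1 where "P1 = Xs\<^sup>T * Gx * Xs * St * Vs\<^sup>T * A * Vs"
  define P2 where "P2 = Xs\<^sup>T * Gxx * Xs * St * Vs\<^sup>T * absA * Vs"
  have P: "dim_row P1 = dim_col Xs" "dim_col P1 = dim_col Vs" "dim_row P2 = dim_col Xs" "dim_col P2 = dim_col Vs"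
    by (simp_all add: P1_def P2_def)
  have "Xs * S_step dt \<sigma> Gx Gxx A absA Xs Vs St * Vs\<^sup>T =
      (1 / (1 + \<sigma> * dt)) \<cdot>\<^sub>m (Xs * St * Vs\<^sup>T - dt \<cdot>\<^sub>m (Xs * P1 * Vs\<^sup>T) + dt \<cdot>\<^sub>m (Xs * P2 * Vs\<^sup>T))"
    unfolding S_step_def P1_def[symmetric] P2_def[symmetric] using P St(2,3)
    by (simp add: mult_mat_distrib mult_mat_distrib' mult_smult_mat)
  also have "Xs * P1 * Vs\<^sup>T = Gx * v0 * A"
    unfolding P1_def using assms by (intro flux) auto
  also have "Xs * P2 * Vs\<^sup>T = Gxx * v0 * absA"
    unfolding P2_def using assms by (intro flux) auto
  finally show "Xs * S_step dt \<sigma> Gx Gxx A absA Xs Vs St * Vs\<^sup>T =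
      (1 / (1 + \<sigma> * dt)) \<cdot>\<^sub>m (v0 - dt \<cdot>\<^sub>m (Gx * v0 * A) + dt \<cdot>\<^sub>m (Gxx * v0 * absA))"
    unfolding 1 .
qed

text \<open>Besides the range of \<open>Vs\<close>, the basis \<open>Va\<close> reproduces the first
  unit vector, hence also \<open>I * Vs\<close>, where \<open>I\<close> erases the zeroth moment.
  Both summands of the augmented coefficients are therefore recovered without error, and they occupy
  disjoint angular columns.\<close>

lemma augmented_S_exact:
  fixes Xtr Str Vs Xa Va :: "real mat"
  assumes dims: "dim_row Xtr = n" "dim_row Str = dim_col Xtr" "dim_col Str = dim_col Vs"
      "dim_row Vs = p" "dim_row Xa = n" "dim_row Va = p" "dim_vec v01 = n"
    and X: "Xa * (Xa\<^sup>T * Xtr) = Xtr" "Xa * (Xa\<^sup>T * col_mat v01) = col_mat v01"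
    and V: "Va * (Va\<^sup>T * Vs) = Vs" "Va * (Va\<^sup>T * col_mat (unit_vec p 0)) = col_mat (unit_vec p 0)"
    and jk: "j < n" "k < p"
  shows "(Xa * augmented_S Xtr Str Vs v01 Xa Va * Va\<^sup>T) $$ (j,k) =
    (if k = 0 then v01 $ j else (Xtr * Str * Vs\<^sup>T) $$ (j,k))"
proof -
  define e where "e = col_mat (unit_vec p 0 :: real vec)"
  define I where "I = 1\<^sub>m p - e * e\<^sup>T"
  have e: "dim_row e = p" "dim_col e = 1" by (simp_all add: e_def)
  have I: "I = mat_diag p (\<lambda>i. if i = 0 then 0 else 1)"
    unfolding I_def e_def by (intro eq_matI) (auto simp: scalar_prod_def mat_diag_def)
  have IT: "I\<^sup>T = I" unfolding I by (auto simp: mat_diag_def intro!: eq_matI)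
  have Ic: "I \<in> carrier_mat p p" unfolding I by simp
  have VI: "Va * (Va\<^sup>T * (I * Vs)) = I * Vs"
  proof -
    have "I * Vs = Vs - e * (e\<^sup>T * Vs)"
      unfolding I_def using dims e by (simp add: mult_mat_distrib mult_mat_assoc)
    moreover have "Va * (Va\<^sup>T * (e * (e\<^sup>T * Vs))) = (Va * (Va\<^sup>T * e)) * (e\<^sup>T * Vs)"
      using dims e by (simp add: mult_mat_assoc)
    ultimately show ?thesis
      using dims e V by (simp add: mult_mat_distrib' e_def[symmetric])
  qed
  \<comment> \<open>The core \<open>1\<^sub>m 1\<close> is inserted to give the rank-one term the
    three-factor shape of \<open>two_sided_projection\<close>.\<close>
  have "Xa * augmented_S Xtr Str Vs v01 Xa Va * Va\<^sup>T =
      Xa * (Xa\<^sup>T * (Xtr * Str * (I * Vs)\<^sup>T) * Va) * Va\<^sup>T + Xa * (Xa\<^sup>T * (col_mat v01 * 1\<^sub>m 1 * e\<^sup>T) * Va) * Va\<^sup>T"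
    unfolding augmented_S_def Let_def dims(4) e_def[symmetric] I_def[symmetric] using dims e Ic
    by (simp add: transpose_mult_mat IT mult_mat_assoc mult_mat_distrib mult_mat_distrib')
  also have "Xa * (Xa\<^sup>T * (Xtr * Str * (I * Vs)\<^sup>T) * Va) * Va\<^sup>T = Xtr * Str * (I * Vs)\<^sup>T"
    using dims Ic X VI by (intro two_sided_projection) auto
  also have "Xa * (Xa\<^sup>T * (col_mat v01 * 1\<^sub>m 1 * e\<^sup>T) * Va) * Va\<^sup>T = col_mat v01 * 1\<^sub>m 1 * e\<^sup>T"
    using dims e X V by (intro two_sided_projection) (auto simp: e_def)
  also have "Xtr * Str * (I * Vs)\<^sup>T = Xtr * Str * Vs\<^sup>T * I"
    using dims Ic by (simp add: transpose_mult_mat IT mult_mat_assoc)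
  also have "\<dots> = Matrix.mat n p (\<lambda>(j,k). (Xtr * Str * Vs\<^sup>T) $$ (j,k) * (if k = 0 then 0 else 1))"
    unfolding I using dims by (intro mat_diag_mult_right) auto
  finally show ?thesis
    using dims jk e by (simp add: scalar_prod_def e_def del: index_mult_mat(1)) (simp add: scalar_prod_def)
qed

text \<open>The absorption-emission terms dissipate \<open>s (u - \<surd>2 b1)\<^sup>2\<close>.\<close>

lemma coupled_square_le:
  fixes u y b0 b1 s :: real
  assumes s: "0 \<le> s" and u: "(1 + s) * u = y + sqrt 2 * s * b1" and b: "(1 + 2 * s) * b1 = b0 + sqrt 2 * s * u"
  shows "u\<^sup>2 + b1\<^sup>2 \<le> y\<^sup>2 + b0\<^sup>2"
proof -
  have y: "y = u + s * (u - sqrt 2 * b1)" using u by (simp add: algebra_simps)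
  have b0: "b0 = b1 - sqrt 2 * s * (u - sqrt 2 * b1)" using b by (simp add: algebra_simps)
  \<comment> \<open>The first two squares are the increments of the implicit step, the last term is
    the relaxation itself.\<close>
  have "y\<^sup>2 + b0\<^sup>2 - (u\<^sup>2 + b1\<^sup>2) = (s * (u - sqrt 2 * b1))\<^sup>2 + (sqrt 2 * s * (u - sqrt 2 * b1))\<^sup>2
      + 2 * s * (u - sqrt 2 * b1)\<^sup>2"
    unfolding y b0 by (simp add: power2_eq_square algebra_simps)
  moreover have "0 \<le> \<dots>" using s by simp
  ultimately show ?thesis by linarith
qed

text \<open>The cells decouple. In each of them the higher moments shrink by the factor
  \<open>1 + s\<close>, while the zeroth moment and the internal energy exchange energy and must be
  estimated jointly.\<close>

lemma relaxation_sum_le: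
  fixes B0 B1 :: "real vec" and vh y :: "real mat"
  assumes s: "0 \<le> s" and p: "0 < p"
    and hi: "\<And>j k. j < n \<Longrightarrow> 0 < k \<Longrightarrow> k < p \<Longrightarrow> (1 + s) * (B1 $ j * vh $$ (j,k)) = y $$ (j,k)"
    and lo: "\<And>j. j < n \<Longrightarrow> (1 + s) * (B1 $ j * vh $$ (j,0)) = y $$ (j,0) + sqrt 2 * s * B1 $ j"
    and B: "\<And>j. j < n \<Longrightarrow> (1 + 2 * s) * B1 $ j = B0 $ j + sqrt 2 * s * (B1 $ j * vh $$ (j,0))"
  shows "(\<Sum>j<n. \<Sum>k<p. (B1 $ j * vh $$ (j,k))\<^sup>2) + (\<Sum>j<n. (B1 $ j)\<^sup>2)
    \<le> (\<Sum>j<n. \<Sum>k<p. (y $$ (j,k))\<^sup>2) + (\<Sum>j<n. (B0 $ j)\<^sup>2)"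
proof -
  obtain q where q: "p = Suc q" using p by (cases p) auto
  have "(\<Sum>k<p. (B1 $ j * vh $$ (j,k))\<^sup>2) + (B1 $ j)\<^sup>2 \<le> (\<Sum>k<p. (y $$ (j,k))\<^sup>2) + (B0 $ j)\<^sup>2"
    if j: "j < n" for j
  proof -
    have "(B1 $ j * vh $$ (j,k))\<^sup>2 \<le> (y $$ (j,k))\<^sup>2" if k: "0 < k" "k < p" for k
    proof -
      have "\<bar>B1 $ j * vh $$ (j,k)\<bar> \<le> \<bar>y $$ (j,k)\<bar>"
        unfolding hi[OF j k, symmetric] abs_mult[of "1 + s"]
        using s mult_right_mono[of 1 "1 + s" "\<bar>B1 $ j * vh $$ (j,k)\<bar>"] by simp
      then show ?thesis by (simp only: abs_le_square_iff)
    qed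
    then have "(\<Sum>k<q. (B1 $ j * vh $$ (j, Suc k))\<^sup>2) \<le> (\<Sum>k<q. (y $$ (j, Suc k))\<^sup>2)"
      by (intro sum_mono) (simp add: q)
    with coupled_square_le[OF s lo[OF j] B[OF j]] show ?thesis
      unfolding q sum.lessThan_Suc_shift by simp
  qed
  then show ?thesis
    unfolding sum.distrib[symmetric] by (intro sum_mono) simp
qed

section \<open>What the orthonormal bases of the scheme contain\<close>

lemma is_qr_dim:
  assumes "is_qr Z Q"
  shows "dim_row Q = dim_row Z" "dim_col Q = dim_col Z"
  using assms by (auto simp: is_qr_def)

lemma is_qr_projection:
  assumes "is_qr Y Q" "mat_range Z \<subseteq> mat_range Y" "dim_row Z = dim_row Y"
  shows "Q * (Q\<^sup>T * Z) = Z"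
  using assms by (intro orthonormal_projection) (auto simp: is_qr_def)

text \<open>Serves the spatial and the angular basis alike, with \<open>W\<close> the result of the
  K-step or the L-step. The range of \<open>X\<close> passes through \<open>H\<close>, those of
  \<open>Y\<close> and \<open>Z\<close> through the nested block
  \<open>Y @\<^sub>c Z\<close>.\<close>

lemma augmented_qr_projection:
  assumes qr1: "is_qr (W @\<^sub>c X) H" and qr2: "is_qr (H @\<^sub>c Y @\<^sub>c Z) Q"
    and dims: "dim_row W = n" "dim_row X = n" "dim_row Y = n" "dim_row Z = n"
  shows "Q * (Q\<^sup>T * X) = X" "Q * (Q\<^sup>T * Y) = Y" "Q * (Q\<^sup>T * Z) = Z"
proof -
  have H: "dim_row H = n" using is_qr_dim[OF qr1] dims by simp
  have "mat_range X \<subseteq> mat_range (W @\<^sub>c X)" using dims by (simp add: mat_range_append_cols2)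
  also have "\<dots> \<subseteq> mat_range H" using qr1 by (simp add: is_qr_def)
  also have "\<dots> \<subseteq> mat_range (H @\<^sub>c Y @\<^sub>c Z)" using dims H by (simp add: mat_range_append_cols1)
  finally show "Q * (Q\<^sup>T * X) = X" using dims H by (intro is_qr_projection[OF qr2]) auto
  have YZ: "mat_range (Y @\<^sub>c Z) \<subseteq> mat_range (H @\<^sub>c Y @\<^sub>c Z)"
    using dims H by (simp add: mat_range_append_cols2)
  have "mat_range Y \<subseteq> mat_range (Y @\<^sub>c Z)" using dims by (simp add: mat_range_append_cols1)
  also note YZ
  finally show "Q * (Q\<^sup>T * Y) = Y" using dims H by (intro is_qr_projection[OF qr2]) auto
  have "mat_range Z \<subseteq> mat_range (Y @\<^sub>c Z)" using dims by (simp add: mat_range_append_cols2)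
  also note YZ
  finally show "Q * (Q\<^sup>T * Z) = Z" using dims H by (intro is_qr_projection[OF qr2]) auto
qed

text \<open>The unit vector is nonzero and already normalized, so the first-column clause of
  \<open>is_qr\<close> returns it unchanged. The conservative truncation relies on this.\<close>

lemma is_qr_first_unit_col:
  assumes qr: "is_qr (col_mat (unit_vec p 0) @\<^sub>c B) Q" and p: "0 < p" and B: "dim_row B = p"
  shows "col Q 0 = unit_vec p 0"
proof -
  let ?Z = "col_mat (unit_vec p 0 :: real vec) @\<^sub>c B"
  have "col ?Z 0 = unit_vec p 0"
    using B by (intro eq_vecI) (auto simp: append_cols_index)
  moreover have "euclid_norm (unit_vec p 0) = 1" using p by (simp add: euclid_norm_def)
  moreover have "unit_vec p 0 \<noteq> (0\<^sub>v p :: real vec)" using p by simp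
  ultimately show ?thesis using qr by (simp add: is_qr_def)
qed

section \<open>Energy balance over one complete time step\<close>

theorem theorem3:
  fixes Nx Nmu r :: nat
    and dx dt \<sigma> \<theta> :: real
    and A absA Q M X0 S0 V0 X1 S1 V1 :: "real mat"
    and B0 B1 :: "real vec"
  assumes "3 \<le> Nx" and "1 \<le> r" and "4 * r + 1 \<le> min Nx Nmu"
    and "dx = 1 / real Nx" and "0 < dt" and "0 \<le> \<sigma>" and "0 \<le> \<theta>"
    and "A = angular_matrix Nmu"
    and "is_eigen_decomposition Nmu A Q M" and "absA = Q * map_mat abs M * Q\<^sup>T"
    and "B0 \<in> carrier_vec Nx" and "\<forall>j<Nx. B0 $ j \<noteq> 0"
    and "X0 \<in> carrier_mat Nx r" and "orthonormal_cols X0"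
    and "S0 \<in> carrier_mat r r"
    and "V0 \<in> carrier_mat Nmu r" and "orthonormal_cols V0"
    and "dlra_step dx dt \<sigma> \<theta> A absA B0 X0 S0 V0 B1 X1 S1 V1"
    and "dt \<le> dx"
  shows "energy B1 (X1 * S1 * V1\<^sup>T) \<le> energy B0 (X0 * S0 * V0\<^sup>T)"
proof -
  define s where "s = \<sigma> * dt"
  define Gx where "Gx = conj_diag B0 (Dx_mat Nx dx)"
  define Gxx where "Gxx = conj_diag B0 (Dxx_mat Nx dx)"
  define v0 where "v0 = X0 * S0 * V0\<^sup>T"
  have B0: "B0 \<in> carrier_vec Nx" "\<forall>j<Nx. B0 $ j \<noteq> 0" and dimB0: "dim_vec B0 = Nx"
    using assms(11,12) by auto
  have s: "0 \<le> s" using assms(5,6) by (simp add: s_def)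
  have dx: "0 < dx" using assms(1,4) by simp
  have p: "0 < Nmu" using assms(2,3) by simp
  have Q: "Q \<in> carrier_mat Nmu Nmu" "M \<in> carrier_mat Nmu Nmu"
    using assms(9) by (auto simp: is_eigen_decomposition_def)
  have A: "A \<in> carrier_mat Nmu Nmu" "absA \<in> carrier_mat Nmu Nmu"
    using Q by (auto simp: assms(8,10) angular_matrix_def)
  have D: "Dx_mat Nx dx \<in> carrier_mat Nx Nx" "Dxx_mat Nx dx \<in> carrier_mat Nx Nx"
    by (simp_all add: Dx_mat_def Dxx_mat_def)
  have G: "Gx \<in> carrier_mat Nx Nx" "Gxx \<in> carrier_mat Nx Nx"
    using D B0 by (auto simp: Gx_def Gxx_def intro: conj_diag_carrier)
  note X0 = assms(13) and S0 = assms(15) and V0 = assms(16)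
  from assms(18) obtain Xh Xs Vh Vs v01 Xtr Str Xa Va where
    qXh: "is_qr (K_step dt \<sigma> Gx Gxx A absA X0 S0 V0 @\<^sub>c X0) Xh"
    and qXs: "is_qr (Xh @\<^sub>c (Gx * X0) @\<^sub>c (Gxx * X0)) Xs"
    and qVh: "is_qr (L_step dt \<sigma> Gx Gxx A absA X0 S0 V0 @\<^sub>c V0) Vh"
    and qVs: "is_qr (Vh @\<^sub>c (A\<^sup>T * V0) @\<^sub>c (absA\<^sup>T * V0)) Vs"
    and cu: "coupled_update dt \<sigma> Gx Gxx A absA B0 v0 Xs (projected_S0 X0 S0 V0 Xs Vs) Vs B1 v01"
    and qXtr: "is_qr_decomposition (mat_diag Nx (\<lambda>j. B0 $ j / B1 $ j) * Xs *
      S_step dt \<sigma> Gx Gxx A absA Xs Vs (projected_S0 X0 S0 V0 Xs Vs)) Xtr Str"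
    and qXa: "is_qr (col_mat v01 @\<^sub>c Xtr) Xa"
    and qVa: "is_qr (col_mat (unit_vec (dim_row Vs) 0) @\<^sub>c Vs) Va"
    and tr: "standard_truncation \<theta> Xa (augmented_S Xtr Str Vs v01 Xa Va) Va X1 S1 V1 \<or>
      conservative_truncation \<theta> Xa (augmented_S Xtr Str Vs v01 Xa Va) Va X1 S1 V1"
    unfolding dlra_step_def Let_def dimB0 Gx_def[symmetric] Gxx_def[symmetric] v0_def[symmetric]
    by (elim exE conjE) (rule that)
  define St where "St = projected_S0 X0 S0 V0 Xs Vs"
  define Ss where "Ss = S_step dt \<sigma> Gx Gxx A absA Xs Vs St"
  \<comment> \<open>\<open>F\<close> is the explicit flux update before division by
    \<open>1 + s\<close>; \<open>vh\<close> below is the solution before truncation.\<close>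
  define F where "F = v0 - dt \<cdot>\<^sub>m (Gx * v0 * A) + dt \<cdot>\<^sub>m (Gxx * v0 * absA)"
  define Sa where "Sa = augmented_S Xtr Str Vs v01 Xa Va"
  define vh where "vh = Xa * Sa * Va\<^sup>T"

  have K: "dim_row (K_step dt \<sigma> Gx Gxx A absA X0 S0 V0) = Nx"
      "dim_col (K_step dt \<sigma> Gx Gxx A absA X0 S0 V0) = r"
    using X0 V0 G by (simp_all add: K_step_def Let_def)
  have L: "dim_row (L_step dt \<sigma> Gx Gxx A absA X0 S0 V0) = Nmu"
      "dim_col (L_step dt \<sigma> Gx Gxx A absA X0 S0 V0) = r"
    using X0 V0 A by (simp_all add: L_step_def Let_def)
  have Xh: "dim_row Xh = Nx" "dim_col Xh = 2 * r" and Vh: "dim_row Vh = Nmu" "dim_col Vh = 2 * r"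
    using is_qr_dim[OF qXh] is_qr_dim[OF qVh] K L X0 V0 by auto
  have Xs: "dim_row Xs = Nx" "dim_col Xs = 4 * r" and Vs: "dim_row Vs = Nmu" "dim_col Vs = 4 * r"
    using is_qr_dim[OF qXs] is_qr_dim[OF qVs] Xh Vh X0 V0 by auto
  have projX: "Xs * (Xs\<^sup>T * X0) = X0" "Xs * (Xs\<^sup>T * (Gx * X0)) = Gx * X0"
      "Xs * (Xs\<^sup>T * (Gxx * X0)) = Gxx * X0"
    using X0 G K by (auto intro!: augmented_qr_projection[OF qXh qXs])
  have projV: "Vs * (Vs\<^sup>T * V0) = V0" "Vs * (Vs\<^sup>T * (A\<^sup>T * V0)) = A\<^sup>T * V0"
      "Vs * (Vs\<^sup>T * (absA\<^sup>T * V0)) = absA\<^sup>T * V0"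
    using V0 A L by (auto intro!: augmented_qr_projection[OF qVh qVs])
  note exact = S_step_exact[OF X0 S0 V0 G A Xs(1) Vs(1) projX projV, folded St_def v0_def]
  have W: "Xs * Ss * Vs\<^sup>T = (1 / (1 + s)) \<cdot>\<^sub>m F"
    unfolding Ss_def s_def F_def by (rule exact(2))
  have v0: "v0 \<in> carrier_mat Nx Nmu" using X0 V0 by (auto simp: v0_def)
  have F: "F \<in> carrier_mat Nx Nmu" using v0 G A by (auto simp: F_def)

  have B1: "B1 \<in> carrier_vec Nx" and v01: "dim_vec v01 = Nx"
    using cu B0 by (auto simp: coupled_update_def)
  have Ss: "dim_row Ss = 4 * r" "dim_col Ss = 4 * r"
    using Xs Vs by (simp_all add: Ss_def S_step_def)
  have Xtr: "dim_row Xtr = Nx" "dim_col Xtr = 4 * r" "dim_row Str = 4 * r" "dim_col Str = 4 * r"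
    and XtrStr: "Xtr * Str = mat_diag Nx (\<lambda>j. B0 $ j / B1 $ j) * Xs * Ss"
    using qXtr Ss unfolding is_qr_decomposition_def St_def[symmetric] Ss_def[symmetric]
    by (auto simp: mat_diag_def)
  have Xa: "Xa \<in> carrier_mat Nx (4 * r + 1)" and Va: "Va \<in> carrier_mat Nmu (4 * r + 1)"
    using is_qr_dim[OF qXa] is_qr_dim[OF qVa] Xtr Vs v01 by auto
  have Sa: "Sa \<in> carrier_mat (4 * r + 1) (4 * r + 1)"
    using Xa Va by (auto simp: Sa_def augmented_S_def Let_def)
  have e1: "col Va 0 = unit_vec Nmu 0" and Vaorth: "orthonormal_cols Va"
    using is_qr_first_unit_col[OF qVa[unfolded Vs(1)]] qVa p Vs(1) by (auto simp: is_qr_def)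
  \<comment> \<open>The factor \<open>B0 $ j / B1 $ j\<close> stems from the transformation step.
    The energy weight \<open>B1 $ j\<close> will cancel it and leave the old weight
    \<open>B0 $ j\<close>.\<close>
  have vh: "vh $$ (j,k) = (if k = 0 then v01 $ j else B0 $ j / B1 $ j * (F $$ (j,k) / (1 + s)))"
    if "j < Nx" "k < Nmu" for j k
  proof -
    have "Xtr * Str * Vs\<^sup>T = mat_diag Nx (\<lambda>j. B0 $ j / B1 $ j) * ((1 / (1 + s)) \<cdot>\<^sub>m F)"
      unfolding XtrStr using Xs Vs Ss by (simp add: mult_mat_assoc mat_diag_def flip: W)
    then have "(Xtr * Str * Vs\<^sup>T) $$ (j,k) = B0 $ j / B1 $ j * (F $$ (j,k) / (1 + s))"
      using that F by (simp add: mat_diag_mult_left[of _ Nx Nmu])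
    then show ?thesis
      unfolding vh_def Sa_def
      by (subst augmented_S_exact[of Xtr Nx Str Vs Nmu Xa Va v01])
        (use that Xtr Vs Xa Va v01 is_qr_projection[OF qXa] is_qr_projection[OF qVa] in
          \<open>auto simp: mat_range_append_cols1 mat_range_append_cols2\<close>)
  qed
  define D0 where "D0 = mat_diag Nx (\<lambda>j. B0 $ j)"
  define U where "U = D0 * v0"
  have D0: "D0 \<in> carrier_mat Nx Nx" by (simp add: D0_def)
  have U: "U \<in> carrier_mat Nx Nmu" using D0 v0 by (simp add: U_def)
  have D0G: "D0 * (Gx * Z) = Dx_mat Nx dx * (D0 * Z)" "D0 * (Gxx * Z) = Dxx_mat Nx dx * (D0 * Z)"
    if "dim_row Z = Nx" for Z
    using mat_diag_mult_conj_diag[OF B0 D(1)] mat_diag_mult_conj_diag[OF B0 D(2)] D0 G D that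
    by (simp_all add: D0_def[symmetric] Gx_def[symmetric] Gxx_def[symmetric] flip: mult_mat_assoc)
  have D0F: "D0 * F = U - dt \<cdot>\<^sub>m (Dx_mat Nx dx * U * A) + dt \<cdot>\<^sub>m (Dxx_mat Nx dx * U * absA)"
    using D0 D v0 G A
    by (simp add: F_def U_def mult_mat_distrib' mult_smult_mat mult_mat_assoc D0G)
  have D0F_index: "(D0 * F) $$ (j,k) = B0 $ j * F $$ (j,k)" if "j < Nx" "k < Nmu" for j k
    using F that unfolding D0_def by (simp add: mat_diag_mult_left[of _ Nx Nmu])

  \<comment> \<open>The coupled update uses the projected \<open>Xs * St * Vs\<^sup>T\<close>, which
    equals \<open>v0\<close>; its explicit part is thus column 0 of the same
    \<open>F\<close>.\<close>
  have flux0: "F $$ (j,0) = v0 $$ (j,0) - dt * (Gx * Xs * St * Vs\<^sup>T * A) $$ (j,0)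
      + dt * (Gxx * Xs * St * Vs\<^sup>T * absA) $$ (j,0)" if "j < Nx" for j
  proof -
    have St: "dim_row St = dim_col Xs" "dim_col St = dim_col Vs"
      by (simp_all add: St_def projected_S0_def)
    have "Gx * Xs * St * Vs\<^sup>T * A = Gx * v0 * A" "Gxx * Xs * St * Vs\<^sup>T * absA = Gxx * v0 * absA"
      using G A Xs Vs St by (simp_all add: mult_mat_assoc flip: exact(1))
    then show ?thesis using that v0 G A p by (simp add: F_def del: index_mult_mat(1))
  qed
  \<comment> \<open>For \<open>B1 $ j = 0\<close> the second coupled equation would read
    \<open>0 = 1\<close>.\<close>
  have B1_ne: "B1 $ j \<noteq> 0" if "j < Nx" for j
    using cu that B0 unfolding coupled_update_def by auto
  have lo: "(1 + s) * (B1 $ j * vh $$ (j,0)) = (D0 * F) $$ (j,0) + sqrt 2 * s * B1 $ j"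
    and hi: "(1 + 2 * s) * B1 $ j = B0 $ j + sqrt 2 * s * (B1 $ j * vh $$ (j,0))"
    if j: "j < Nx" for j
  proof -
    have 1: "B1 $ j / B0 $ j * v01 $ j = 1 / (1 + s) * (F $$ (j,0) + sqrt 2 * s * (B1 $ j / B0 $ j))"
      and 2: "B1 $ j / B0 $ j = 1 + s * (B1 $ j / B0 $ j) * (sqrt 2 * v01 $ j - 2)"
      using cu j unfolding coupled_update_def dimB0 St_def[symmetric] flux0[OF j] s_def
        mult.assoc[of "sqrt 2" \<sigma> dt] by blast+
    have nz: "B0 $ j \<noteq> 0" "1 + s \<noteq> 0" using B0 j s by auto
    \<comment> \<open>The scheme is written in the ratio \<open>b\<close>. Multiplication by
      \<open>B0 $ j\<close> yields equations that are linear in \<open>B1 $ j\<close> and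
      \<open>B1 $ j * vh $$ (j,0)\<close>, the quantities in the energy.\<close>
    define b where "b = B1 $ j / B0 $ j"
    have B1_eq: "B1 $ j = b * B0 $ j" using nz by (simp add: b_def)
    have 3: "(1 + s) * (b * v01 $ j) = F $$ (j,0) + sqrt 2 * s * b"
      unfolding 1[folded b_def] using nz(2) by simp
    have vh0: "vh $$ (j,0) = v01 $ j" using vh j p by simp
    show "(1 + s) * (B1 $ j * vh $$ (j,0)) = (D0 * F) $$ (j,0) + sqrt 2 * s * B1 $ j"
      unfolding vh0 D0F_index[OF j p] B1_eq using arg_cong[OF 3, of "\<lambda>x. x * B0 $ j"] by (simp add: algebra_simps)
    show "(1 + 2 * s) * B1 $ j = B0 $ j + sqrt 2 * s * (B1 $ j * vh $$ (j,0))"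
      unfolding vh0 B1_eq using arg_cong[OF 2[folded b_def], of "\<lambda>x. x * B0 $ j"] by (simp add: algebra_simps)
  qed
  \<comment> \<open>The estimates are chained backwards through the scheme: truncation, relaxation,
    transport.\<close>
  have "energy B1 (X1 * S1 * V1\<^sup>T) \<le> energy B1 vh"
    unfolding vh_def using tr[folded Sa_def] Xa Sa Va e1 Vaorth B1
    by (intro truncation_energy_le) auto
  also have "\<dots> = ((\<Sum>j<Nx. \<Sum>k<Nmu. (B1 $ j * vh $$ (j,k))\<^sup>2) + (\<Sum>j<Nx. (B1 $ j)\<^sup>2)) / 2"
    using B1 Va by (simp add: energy_def vh_def)
  also have "\<dots> \<le> ((\<Sum>j<Nx. \<Sum>k<Nmu. ((D0 * F) $$ (j,k))\<^sup>2) + (\<Sum>j<Nx. (B0 $ j)\<^sup>2)) / 2"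
  proof (intro divide_right_mono relaxation_sum_le[OF s p _ lo hi])
    fix j k assume jk: "j < Nx" "0 < k" "k < Nmu"
    then show "(1 + s) * (B1 $ j * vh $$ (j,k)) = (D0 * F) $$ (j,k)"
      using B1_ne[OF jk(1)] s by (simp add: vh D0F_index del: index_mult_mat(1))
  qed auto
  also have "(\<Sum>j<Nx. \<Sum>k<Nmu. ((D0 * F) $$ (j,k))\<^sup>2) = sqnorm (D0 * F)"
    using D0 F by (simp add: sqnorm_def)
  also have "sqnorm (D0 * F) \<le> sqnorm U"
    unfolding D0F
    using sqnorm_upwind_le[OF assms(1) dx assms(5,19,9) _ assms(10) U]
      abs_eigenvalue_angular_matrix_le_1[OF assms(9)[unfolded assms(8)]] by blast
  finally show ?thesis
    using energy_eq_sqnorm[OF B0(1), of v0] X0 by (simp add: U_def D0_def v0_def)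
qed

end
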